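(* Fix $n\in\mathbb N$ and $K\in[1,\infty)$. Given a metric space $(X,d_X)$, the following two assertions are equivalent. (1) For every symmetric stochastic matrix $A\in M_n(\mathbb R)$ we have $\gamma(A,d_X^2)\le \dfrac{K}{1-\lambda_2(A)}$. (2) For every $D\in(K,\infty)$ and every $x_1,\ldots,x_n\in X$ there exists a nonconstant mapping $f:\{x_1,\ldots,x_n\}\to\ell_2$ that satisfies $$\sum_{i=1}^n\sum_{j=1}^n \|f(x_i)-f(x_j)\|_{\ell_2}^2\ \ge\ \frac{\|f\|_{\mathrm{Lip}}^2}{D}\sum_{i=1}^n\sum_{j=1}^n d_X(x_i,x_j)^2 .$$
   Context: All metric spaces are assumed to contain at least two points. An $n\times n$ real matrix $A=(a_{ij})$ is symmetric stochastic if it is symmetric, has nonnegative entries, and each row sums to $1$; its eigenvalues in decreasing order are $1=\lambda_1(A)\ge\lambda_2(A)\ge\cdots\ge\lambda_n(A)$. The expression $K/(1-\lambda_2(A))$ is read as $\infty$ if $\lambda_2(A)=1$. $\gamma(A,d_X^2)$ denotes the infimum over those $\gamma\in(0,\infty]$ such that every $x_1,\ldots,x_n\in X$ satisfy $$\frac1{n^2}\sum_{i=1}^n\sum_{j=1}^n d_X(x_i,x_j)^2\le \frac{\gamma}{n}\sum_{i=1}^n\sum_{j=1}^n a_{ij}d_X(x_i,x_j)^2 .$$ $\|f\|_{\mathrm{Lip}}$ is the Lipschitz constant of $f$ with respect to $d_X$ on $\{x_1,\ldots,x_n\}$ and the $\ell_2$ norm.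
   Formalization: In assertion (2) the points x_1,...,x_n are assumed not all equal: if they coincide, no nonconstant map on the singleton {x_1,...,x_n} exists, so (2) would fail even where (1) holds, e.g. for a two-point space with K=1. *)

theory Defs
  imports "HOL-Analysis.Analysis" "Jordan_Normal_Form.Char_Poly"
begin

text \<open>Indices run over \<open>0, \<dots>, n - 1\<close> instead of \<open>1, \<dots>, n\<close>.\<close>

definition symmetric_stochastic :: "nat \<Rightarrow> real mat \<Rightarrow> bool" where
  "symmetric_stochastic n A \<longleftrightarrow>
     A \<in> carrier_mat n n \<and> transpose_mat A = A \<and>
     (\<forall>i<n. \<forall>j<n. A $$ (i, j) \<ge> 0) \<and>
     (\<forall>i<n. (\<Sum>j<n. A $$ (i, j)) = 1)"

text \<open>The real roots of the characteristic polynomial, with multiplicity and in decreasing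
  order; for a symmetric \<open>n \<times> n\<close> matrix this list has length \<open>n\<close>.\<close>

definition eigenvalue_list :: "real mat \<Rightarrow> real list" where
  "eigenvalue_list A = rev (sorted_list_of_multiset (proots (char_poly A)))"

text \<open>The \<open>k\<close>-th largest eigenvalue, counting from \<open>k = 1\<close>. Past the end of the list the
  value is \<open>0\<close>; for \<open>k = 2\<close> and a symmetric matrix this only concerns \<open>1 \<times> 1\<close> matrices,
  which have no second eigenvalue.\<close>

definition lambda :: "nat \<Rightarrow> real mat \<Rightarrow> real" where
  "lambda k A =
     (if 1 \<le> k \<and> k \<le> length (eigenvalue_list A) then eigenvalue_list A ! (k - 1) else 0)"

definition gap_bound :: "real \<Rightarrow> real mat \<Rightarrow> ereal" where
  "gap_bound K A = (if lambda 2 A = 1 then \<infinity> else ereal (K / (1 - lambda 2 A)))"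

text \<open>With \<open>ereal\<close>'s convention \<open>\<infinity> * 0 = 0\<close> the set below can be empty; its infimum
  is then \<open>\<infinity>\<close>, the same value as under the convention that \<open>\<gamma> = \<infinity>\<close> is always
  admissible.\<close>

definition gamma_sq :: "nat \<Rightarrow> real mat \<Rightarrow> 'a set \<Rightarrow> ('a \<Rightarrow> 'a \<Rightarrow> real) \<Rightarrow> ereal" where
  "gamma_sq n A X d =
     Inf {g::ereal. 0 < g \<and>
       (\<forall>x::nat \<Rightarrow> 'a. x ` {..<n} \<subseteq> X \<longrightarrow>
          ereal (1 / (real n)\<^sup>2 * (\<Sum>i<n. \<Sum>j<n. (d (x i) (x j))\<^sup>2))
            \<le> g / ereal (real n) * ereal (\<Sum>i<n. \<Sum>j<n. A $$ (i, j) * (d (x i) (x j))\<^sup>2))}"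

definition ell2 :: "(nat \<Rightarrow> real) set" where
  "ell2 = {u. summable (\<lambda>k. (u k)\<^sup>2)}"

definition ell2_norm :: "(nat \<Rightarrow> real) \<Rightarrow> real" where
  "ell2_norm u = sqrt (\<Sum>k. (u k)\<^sup>2)"

text \<open>The least Lipschitz constant of \<open>f\<close> on \<open>S\<close>. The set is nonempty whenever \<open>S\<close> is a
  finite subset of a metric space, the only case in which it is used.\<close>

definition lip_norm :: "('a \<Rightarrow> 'a \<Rightarrow> real) \<Rightarrow> 'a set \<Rightarrow> ('a \<Rightarrow> nat \<Rightarrow> real) \<Rightarrow> real" where
  "lip_norm d S f = Inf {L. 0 \<le> L \<and> (\<forall>p\<in>S. \<forall>q\<in>S. ell2_norm (f p - f q) \<le> L * d p q)}"

end

(* The number 1 - lambda_2(A) is the best constant in the Poincare inequality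
     (1 - lambda_2(A)) sum_ij (u_i - u_j)^2 <= n sum_ij a_ij (u_i - u_j)^2
   for real sequences u, hence also for sequences in l_2, coordinate by coordinate. Composing it
   with a Lipschitz map f into l_2 bounds the sum of the d(x_i,x_j)^2 by that of the
   a_ij d(x_i,x_j)^2, which is (2) => (1).

   Conversely, symmetric weights w >= 0 give the symmetric stochastic matrix I - eps L_w, where
   L_w is the graph Laplacian. Assertion (1) for it, with a second eigenvector u rescaled so that
   sum_ij (u_i - u_j)^2 = sum_ij d(x_i,x_j)^2, says
     sum_ij w_ij (u_i - u_j)^2 <= K sum_ij w_ij d(x_i,x_j)^2.
   By duality over the compact convex set of normalized positive semidefinite kernels, a single
   kernel works for all w at once; its factorization is an embedding f with
   |f(x_i) - f(x_j)|^2 <= K d(x_i,x_j)^2 for all i, j.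

   To identify lambda_2 in the multiset of roots of the characteristic polynomial, split off the
   factor X - 1 by passing to the quotient by constant vectors: the roots of the other factor
   are the eigenvalues on the sum-zero hyperplane, where the largest is the maximum of the
   Rayleigh quotient. *)
theory Submission
  imports Defs
begin

section \<open>Quadratic forms and the Rayleigh quotient on the sum-zero hyperplane\<close>

lemma sum_square_differences:
  fixes u :: "nat \<Rightarrow> real"
  shows "(\<Sum>i<n. \<Sum>j<n. (u i - u j)\<^sup>2) = 2 * real n * (\<Sum>i<n. (u i)\<^sup>2) - 2 * (\<Sum>i<n. u i)\<^sup>2"
proof -
  have "(\<Sum>i<n. u i)\<^sup>2 = (\<Sum>i<n. \<Sum>j<n. u i * u j)"
    by (simp add: power2_eq_square sum_product)
  then show ?thesis
    by (simp add: power2_diff sum.distrib sum_subtractf mult.assoc flip: sum_distrib_left)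
qed

text \<open>By symmetry the columns also sum to 1, so each of the two square terms contributes the
  squared norm of \<open>u\<close>. The result is the Dirichlet form 2 <(I - A) u, u>.\<close>

lemma weighted_sum_square_differences:
  fixes a :: "nat \<Rightarrow> nat \<Rightarrow> real"
  assumes sym: "\<And>i j. i < n \<Longrightarrow> j < n \<Longrightarrow> a i j = a j i"
    and row: "\<And>i. i < n \<Longrightarrow> (\<Sum>j<n. a i j) = 1"
  shows "(\<Sum>i<n. \<Sum>j<n. a i j * (u i - u j)\<^sup>2) =
    2 * ((\<Sum>i<n. (u i)\<^sup>2) - (\<Sum>i<n. \<Sum>j<n. a i j * (u i * u j)))"
proof -
  have 1: "(\<Sum>i<n. \<Sum>j<n. a i j * (u i)\<^sup>2) = (\<Sum>i<n. (u i)\<^sup>2)"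
    by (rule sum.cong) (simp_all add: row flip: sum_distrib_right)
  have "(\<Sum>i<n. \<Sum>j<n. a i j * (u j)\<^sup>2) = (\<Sum>j<n. \<Sum>i<n. a i j * (u j)\<^sup>2)"
    by (rule sum.swap)
  also have "\<dots> = (\<Sum>i<n. \<Sum>j<n. a i j * (u i)\<^sup>2)"
    by (intro sum.cong refl) (simp add: sym)
  finally have 2: "(\<Sum>i<n. \<Sum>j<n. a i j * (u j)\<^sup>2) = (\<Sum>i<n. (u i)\<^sup>2)"
    using 1 by simp
  have "a i j * (u i - u j)\<^sup>2 = a i j * (u i)\<^sup>2 + a i j * (u j)\<^sup>2 - 2 * (a i j * (u i * u j))" for i j
    by (simp add: power2_eq_square algebra_simps)
  then have "(\<Sum>i<n. \<Sum>j<n. a i j * (u i - u j)\<^sup>2) =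
      (\<Sum>i<n. \<Sum>j<n. a i j * (u i)\<^sup>2) + (\<Sum>i<n. \<Sum>j<n. a i j * (u j)\<^sup>2)
      - 2 * (\<Sum>i<n. \<Sum>j<n. a i j * (u i * u j))"
    by (simp add: sum.distrib sum_subtractf sum_distrib_left)
  then show ?thesis
    using 1 2 by simp
qed

text \<open>Divide by \<open>t\<close> and let it tend to 0. Both extremal arguments below, for the
  Rayleigh quotient and for kernels, get their first-order condition from this.\<close>

lemma first_order_nonneg:
  fixes b c :: real
  assumes "\<And>t. 0 < t \<Longrightarrow> t \<le> 1 \<Longrightarrow> 0 \<le> 2 * t * b + t\<^sup>2 * c"
  shows "0 \<le> b"
proof (rule ccontr)
  assume b: "\<not> 0 \<le> b"
  \<comment> \<open>With this \<open>t\<close> the term \<open>t * c\<close> is at most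
    \<open>- b\<close>, too small to compensate \<open>2 * b\<close>.\<close>
  define t where "t = min 1 (- b / (\<bar>c\<bar> + 1))"
  have t: "0 < t" "t \<le> 1"
    using b by (auto simp: t_def divide_neg_pos)
  have "t * (\<bar>c\<bar> + 1) \<le> - b"
    using b by (simp add: t_def flip: pos_le_divide_eq)
  moreover have "t * c \<le> t * (\<bar>c\<bar> + 1)"
    using t by (intro mult_left_mono) auto
  ultimately have "2 * b + t * c < 0"
    using b by linarith
  then have "t * (2 * b + t * c) < 0"
    using t by (simp add: mult_pos_neg)
  with assms[OF t] show False
    by (simp add: power2_eq_square algebra_simps)
qed

text \<open>Tychonoff's theorem. Vectors and kernels are functions on \<open>nat\<close> or on
  pairs, so compactness is taken in the product topology with all coordinates bounded, including
  those outside the range of the sums.\<close>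

lemma compact_cube: "compact {f :: 'i \<Rightarrow> real. \<forall>i. f i \<in> {- c..c}}"
proof -
  have "compactin (product_topology (\<lambda>i::'i. euclideanreal) UNIV) (PiE UNIV (\<lambda>i. {- c..c}))"
    by (simp add: compactin_PiE)
  moreover have "PiE UNIV (\<lambda>i. {- c..c}) = {f :: 'i \<Rightarrow> real. \<forall>i. f i \<in> {- c..c}}"
    by (auto simp: PiE_def Pi_def)
  ultimately show ?thesis
    by (simp add: euclidean_product_topology)
qed

text \<open>The quadratic form has a maximizer \<open>u\<close> on the unit sphere of the hyperplane
  by compactness. Varying it along its residual A u - q(u) u, which again sums to zero, shows that
  the residual vanishes.\<close>

lemma max_Rayleigh_quotient_eigenvector:
  fixes a :: "nat \<Rightarrow> nat \<Rightarrow> real"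
  assumes n: "2 \<le> n"
    and sym: "\<And>i j. i < n \<Longrightarrow> j < n \<Longrightarrow> a i j = a j i"
    and row: "\<And>i. i < n \<Longrightarrow> (\<Sum>j<n. a i j) = 1"
  obtains \<mu> u where "(\<Sum>i<n. u i) = 0" "(\<Sum>i<n. (u i)\<^sup>2) = 1"
    "\<And>i. i < n \<Longrightarrow> (\<Sum>j<n. a i j * u j) = \<mu> * u i"
    "\<And>v. (\<Sum>i<n. v i) = 0 \<Longrightarrow>
      (\<Sum>i<n. \<Sum>j<n. a i j * (v i * v j)) \<le> \<mu> * (\<Sum>i<n. (v i)\<^sup>2)"
proof -
  define S where "S = {u :: nat \<Rightarrow> real. \<forall>i. u i \<in> {- 1..1}} \<inter>
    {u. (\<Sum>i<n. u i) = 0} \<inter> {u. (\<Sum>i<n. (u i)\<^sup>2) = 1}"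
  define q where "q = (\<lambda>u :: nat \<Rightarrow> real. \<Sum>i<n. \<Sum>j<n. a i j * (u i * u j))"
  have normalize: "(\<lambda>i. if i < n then v i / sqrt r else 0) \<in> S"
      "q (\<lambda>i. if i < n then v i / sqrt r else 0) = q v / r"
    if v: "(\<Sum>i<n. v i) = 0" "r = (\<Sum>i<n. (v i)\<^sup>2)" "r > 0" for v r
  proof -
    have "\<bar>v i\<bar> \<le> sqrt r" if "i < n" for i
      using that v(2) by (intro real_le_rsqrt) (auto intro!: member_le_sum)
    then have "v i / sqrt r \<in> {- 1..1}" if "i < n" for i
      using that v(3) by (auto simp: divide_simps abs_le_iff minus_le_iff)
    moreover have "(\<Sum>i<n. v i / sqrt r) = 0"
      using v(1) by (simp flip: sum_divide_distrib)
    moreover have "(\<Sum>i<n. (v i / sqrt r)\<^sup>2) = 1"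
      using v(2,3) by (simp add: power_divide flip: sum_divide_distrib)
    ultimately show "(\<lambda>i. if i < n then v i / sqrt r else 0) \<in> S"
      by (auto simp: S_def)
    show "q (\<lambda>i. if i < n then v i / sqrt r else 0) = q v / r"
      using v(3) by (simp add: q_def sum_divide_distrib)
  qed
  have "compact S"
    unfolding S_def Int_assoc
    by (intro compact_Int_closed compact_cube closed_Int closed_Collect_eq continuous_intros)
      (auto intro!: continuous_on_product_coordinates continuous_intros)
  moreover have "S \<noteq> {}"
  proof -
    \<comment> \<open>The difference of two unit vectors lies in the hyperplane;
      \<open>2 \<le> n\<close> makes room for it.\<close>
    define v where "v = (\<lambda>i::nat. if i = 0 then 1 else if i = 1 then -1 else 0 :: real)"
    have nn: "{..<n} = {0, 1} \<union> {2..<n}"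
      using n by auto
    have "(\<Sum>i<n. v i) = 0" "(\<Sum>i<n. (v i)\<^sup>2) = 2"
      unfolding nn by (simp_all add: v_def sum.union_disjoint)
    then show ?thesis
      using normalize(1)[of v 2] by auto
  qed
  moreover have "continuous_on S q"
    unfolding q_def by (intro continuous_intros continuous_on_subset[OF continuous_on_product_coordinates]) auto
  ultimately obtain u where u: "u \<in> S" and max: "\<And>v. v \<in> S \<Longrightarrow> q v \<le> q u"
    using continuous_attains_sup by metis
  have u0: "(\<Sum>i<n. u i) = 0" and u1: "(\<Sum>i<n. (u i)\<^sup>2) = 1"
    using u by (auto simp: S_def)
  have le: "q v \<le> q u * (\<Sum>i<n. (v i)\<^sup>2)" if v: "(\<Sum>i<n. v i) = 0" for v
  proof (cases "(\<Sum>i<n. (v i)\<^sup>2) = 0")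
    case True
    then have "\<forall>i<n. v i = 0"
      by (subst (asm) sum_nonneg_eq_0_iff) auto
    then show ?thesis
      by (simp add: q_def True)
  next
    case False
    then have pos: "(\<Sum>i<n. (v i)\<^sup>2) > 0"
      by (simp add: order_less_le sum_nonneg)
    show ?thesis
      using max[OF normalize(1)[OF v refl pos]] pos unfolding normalize(2)[OF v refl pos]
      by (simp add: divide_simps)
  qed
  define w where "w = (\<lambda>i. (\<Sum>j<n. a i j * u j) - q u * u i)"
  \<comment> \<open>The columns sum to 1 by symmetry, so the hyperplane is preserved.\<close>
  have w_sum: "(\<Sum>i<n. w i) = 0"
  proof -
    have "(\<Sum>i<n. \<Sum>j<n. a i j * u j) = (\<Sum>j<n. \<Sum>i<n. a j i * u j)"
      by (subst sum.swap) (auto intro!: sum.cong simp: sym)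
    also have "\<dots> = (\<Sum>j<n. u j)"
      by (intro sum.cong) (simp_all add: row flip: sum_distrib_right)
    finally show ?thesis
      using u0 by (simp add: w_def sum_subtractf flip: sum_distrib_left)
  qed
  have expand: "q (\<lambda>i. u i + t * w i) = q u + 2 * t * (\<Sum>i<n. w i * (\<Sum>j<n. a i j * u j)) + t\<^sup>2 * q w" for t
  proof -
    have *: "(\<Sum>i<n. \<Sum>j<n. a i j * (u i * w j)) = (\<Sum>i<n. w i * (\<Sum>j<n. a i j * u j))"
      unfolding sum_distrib_left by (subst sum.swap) (auto intro!: sum.cong simp: sym)
    have "a i j * ((u i + t * w i) * (u j + t * w j)) =
        a i j * (u i * u j) + t * (a i j * (u i * w j)) + t * (w i * (a i j * u j)) + t\<^sup>2 * (a i j * (w i * w j))" for i j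
      by (simp add: power2_eq_square algebra_simps)
    then have "q (\<lambda>i. u i + t * w i) = q u + t * (\<Sum>i<n. \<Sum>j<n. a i j * (u i * w j))
        + t * (\<Sum>i<n. w i * (\<Sum>j<n. a i j * u j)) + t\<^sup>2 * q w"
      by (simp add: q_def sum.distrib sum_distrib_left)
    then show ?thesis
      by (simp add: *)
  qed
  have expand': "(\<Sum>i<n. (u i + t * w i)\<^sup>2) = 1 + 2 * t * (\<Sum>i<n. w i * u i) + t\<^sup>2 * (\<Sum>i<n. (w i)\<^sup>2)" for t
    by (simp add: power2_sum power_mult_distrib sum.distrib u1 sum_distrib_left mult_ac)
  \<comment> \<open>The first-order term of q(u) |u + t w|^2 - q(u + t w) is -2 t |w|^2, while the
    difference is nonnegative by maximality.\<close>
  have "0 \<le> - (\<Sum>i<n. (w i)\<^sup>2)"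
  proof (rule first_order_nonneg)
    fix t :: real
    have "(\<Sum>i<n. u i + t * w i) = 0"
      using u0 w_sum by (simp add: sum.distrib flip: sum_distrib_left)
    from le[OF this, unfolded expand expand']
    have "0 \<le> 2 * t * (q u * (\<Sum>i<n. w i * u i) - (\<Sum>i<n. w i * (\<Sum>j<n. a i j * u j)))
      + t\<^sup>2 * (q u * (\<Sum>i<n. (w i)\<^sup>2) - q w)"
      by (simp add: algebra_simps)
    moreover have "q u * (\<Sum>i<n. w i * u i) - (\<Sum>i<n. w i * (\<Sum>j<n. a i j * u j)) = - (\<Sum>i<n. (w i)\<^sup>2)"
    proof -
      have *: "q u * (w i * u i) - w i * s = - (w i)\<^sup>2" if "w i = s - q u * u i" for i s
      proof -
        from that have s: "s = w i + q u * u i"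
          by simp
        show ?thesis
          unfolding s by (simp add: power2_eq_square algebra_simps)
      qed
      have "(\<Sum>i<n. q u * (w i * u i) - w i * (\<Sum>j<n. a i j * u j)) = (\<Sum>i<n. - (w i)\<^sup>2)"
        by (intro sum.cong refl *) (simp add: w_def)
      then show ?thesis
        by (simp only: sum_subtractf sum_distrib_left[symmetric] sum_negf)
    qed
    ultimately show "0 \<le> 2 * t * - (\<Sum>i<n. (w i)\<^sup>2) + t\<^sup>2 * (q u * (\<Sum>i<n. (w i)\<^sup>2) - q w)"
      by simp
  qed
  then have "(\<Sum>i<n. (w i)\<^sup>2) = 0"
    using sum_nonneg[of "{..<n}" "\<lambda>i. (w i)\<^sup>2"] by simp
  then have "\<forall>i<n. w i = 0"
    by (subst (asm) sum_nonneg_eq_0_iff) auto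
  with that[of u "q u"] u0 u1 le show ?thesis
    by (auto simp: w_def q_def)
qed

section \<open>The second eigenvalue of a symmetric stochastic matrix\<close>

text \<open>When the rows of \<open>A\<close> have a common sum, \<open>A\<close> acts on the quotient by the constant vectors;
  this is its matrix in the basis of classes of the unit vectors other than the zeroth.\<close>

definition quotient_mat :: "nat \<Rightarrow> 'a :: minus mat \<Rightarrow> 'a mat" where
  "quotient_mat m A = Matrix.mat m m (\<lambda>(i, j). A $$ (Suc i, Suc j) - A $$ (0, Suc j))"

lemma quotient_mat_carrier [simp]: "quotient_mat m A \<in> carrier_mat m m"
  by (simp add: quotient_mat_def)

text \<open>In the basis formed by the all-ones vector and the unit vectors other than the zeroth,
  the matrix is block upper triangular: all-ones is an eigenvector for \<open>r\<close>, and the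
  other diagonal block is the action on the quotient.\<close>

lemma char_poly_constant_row_sum:
  fixes A :: "'a :: idom mat"
  assumes A: "A \<in> carrier_mat (Suc m) (Suc m)"
    and row: "\<And>i. i < Suc m \<Longrightarrow> (\<Sum>j<Suc m. A $$ (i, j)) = r"
  shows "char_poly A = [:- r, 1:] * char_poly (quotient_mat m A)"
proof -
  define R where "R = Matrix.mat 1 1 (\<lambda>_. r)"
  define b where "b = Matrix.mat 1 m (\<lambda>(i, j). A $$ (0, Suc j))"
  define e where "e = Matrix.mat m 1 (\<lambda>_. 1 :: 'a)"
  \<comment> \<open>The columns of \<open>P\<close> are the new basis, and \<open>Q\<close> is its
    inverse.\<close>
  define P where "P = four_block_mat (1\<^sub>m 1) (0\<^sub>m 1 m) e (1\<^sub>m m)"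
  define Q where "Q = four_block_mat (1\<^sub>m 1) (0\<^sub>m 1 m) (- e) (1\<^sub>m m)"
  define T where "T = four_block_mat R b (0\<^sub>m m 1) (quotient_mat m A)"
  have c [simp]: "R \<in> carrier_mat 1 1" "b \<in> carrier_mat 1 m" "e \<in> carrier_mat m 1"
    by (auto simp: R_def b_def e_def)
  note c' [simp] = c[unfolded One_nat_def] uminus_carrier_mat[OF c(3)[unfolded One_nat_def]]
  have q [simp]: "0\<^sub>m (Suc 0) m * quotient_mat m A = 0\<^sub>m (Suc 0) m" "1\<^sub>m m * quotient_mat m A = quotient_mat m A"
    by (rule left_mult_zero_mat[OF quotient_mat_carrier], rule left_mult_one_mat[OF quotient_mat_carrier])
  have eR: "e * R \<in> carrier_mat m (Suc 0)" and eb: "e * b + quotient_mat m A \<in> carrier_mat m m"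
    by (auto intro: mult_carrier_mat[OF c'(3) c'(1)])
  note s [simp] = eR eb left_mult_one_mat[OF c'(1)] left_mult_one_mat[OF c'(2)]
    right_add_zero_mat[OF c'(1)] right_add_zero_mat[OF c'(2)] right_add_zero_mat[OF eR]
    right_mult_one_mat[OF c'(1)] right_mult_zero_mat[OF c'(1)] right_mult_one_mat[OF c'(2)]
    left_add_zero_mat[OF c'(2)] right_mult_one_mat[OF eR] right_mult_zero_mat[OF eR]
    right_mult_one_mat[OF eb] left_add_zero_mat[OF eb]
  \<comment> \<open>The blocks of \<open>T\<close> record the columns other than the zeroth; the
    zeroth is recovered from the row sums.\<close>
  have row': "A $$ (i, 0) = r - (\<Sum>j<m. A $$ (i, Suc j))" if "i < Suc m" for i
    using row[OF that] unfolding sum.lessThan_Suc_shift by (simp add: algebra_simps)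
  have PQ: "P * Q = 1\<^sub>m (Suc m)"
  proof -
    have "P * Q = four_block_mat (1\<^sub>m 1) (0\<^sub>m 1 m) (0\<^sub>m m 1) (1\<^sub>m m)"
      unfolding P_def Q_def
      by (subst mult_four_block_mat[where ?nr1.0 = 1 and ?n1.0 = 1 and ?n2.0 = m and ?nr2.0 = m and ?nc1.0 = 1 and ?nc2.0 = m])
        (auto intro!: eq_matI arg_cong2[where f = "four_block_mat _ _"] simp: e_def)
    then show ?thesis by simp
  qed
  have QP: "Q * P = 1\<^sub>m (Suc m)"
  proof -
    have "Q * P = four_block_mat (1\<^sub>m 1) (0\<^sub>m 1 m) (0\<^sub>m m 1) (1\<^sub>m m)"
      unfolding P_def Q_def
      by (subst mult_four_block_mat[where ?nr1.0 = 1 and ?n1.0 = 1 and ?n2.0 = m and ?nr2.0 = m and ?nc1.0 = 1 and ?nc2.0 = m])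
        (auto intro!: eq_matI arg_cong2[where f = "four_block_mat _ _"] simp: e_def)
    then show ?thesis by simp
  qed
  have "P * T = four_block_mat R b (e * R) (e * b + quotient_mat m A)"
    unfolding P_def T_def
    by (subst mult_four_block_mat[where ?nr1.0 = 1 and ?n1.0 = 1 and ?n2.0 = m and ?nr2.0 = m and ?nc1.0 = 1 and ?nc2.0 = m])
      auto
  then have "P * T * Q = four_block_mat (R + b * (- e)) b
      (e * R + (e * b + quotient_mat m A) * (- e)) (e * b + quotient_mat m A)"
    unfolding Q_def
    by (simp, subst mult_four_block_mat[where ?nr1.0 = 1 and ?n1.0 = 1 and ?n2.0 = m and ?nr2.0 = m and ?nc1.0 = 1 and ?nc2.0 = m])
      auto
  also have "\<dots> = A"
    by (rule eq_matI)
      (use A in \<open>auto simp: R_def b_def e_def quotient_mat_def four_block_mat_def scalar_prod_def row'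
        sum_negf lessThan_atLeast0 less_Suc_eq_0_disj\<close>)
  finally have "A = P * T * Q" ..
  moreover have "P \<in> carrier_mat (1 + m) (1 + m)" "Q \<in> carrier_mat (1 + m) (1 + m)"
      "T \<in> carrier_mat (1 + m) (1 + m)"
    unfolding P_def Q_def T_def by (rule four_block_carrier_mat; simp)+
  ultimately have "similar_mat_wit A T P Q"
    using A PQ QP by (intro similar_mat_witI[where n = "Suc m"]) auto
  then have "char_poly A = char_poly T"
    by (intro char_poly_similar) (auto simp: similar_mat_def)
  also have "\<dots> = char_poly R * char_poly (quotient_mat m A)"
    unfolding T_def by (rule char_poly_four_block_zeros_col) auto
  also have "char_poly R = [:- r, 1:]"
    by (subst char_poly_upper_triangular[where n = 1]) (auto simp: R_def diag_mat_def)
  finally show ?thesis .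
qed

section \<open>The quotient by constants as the sum-zero hyperplane\<close>

lemma symmetric_stochasticD:
  assumes "symmetric_stochastic n A"
  shows "A \<in> carrier_mat n n"
    and "\<And>i j. i < n \<Longrightarrow> j < n \<Longrightarrow> A $$ (i, j) = A $$ (j, i)"
    and "\<And>i j. i < n \<Longrightarrow> j < n \<Longrightarrow> 0 \<le> A $$ (i, j)"
    and "\<And>i. i < n \<Longrightarrow> (\<Sum>j<n. A $$ (i, j)) = 1"
proof -
  from assms show A: "A \<in> carrier_mat n n" and "\<And>i j. i < n \<Longrightarrow> j < n \<Longrightarrow> 0 \<le> A $$ (i, j)"
    and "\<And>i. i < n \<Longrightarrow> (\<Sum>j<n. A $$ (i, j)) = 1"
    by (auto simp: symmetric_stochastic_def)
  fix i j assume "i < n" "j < n"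
  moreover have "transpose_mat A = A"
    using assms by (simp add: symmetric_stochastic_def)
  ultimately show "A $$ (i, j) = A $$ (j, i)"
    using A by (metis carrier_matD index_transpose_mat(1))
qed

lemma eigenvalue_iff_sum:
  "eigenvalue (Matrix.mat m m (\<lambda>(i, j). f i j)) (\<mu> :: real) \<longleftrightarrow>
    (\<exists>v. (\<exists>i<m. v i \<noteq> 0) \<and> (\<forall>i<m. (\<Sum>j<m. f i j * v j) = \<mu> * v i))"
proof
  assume "eigenvalue (Matrix.mat m m (\<lambda>(i, j). f i j)) \<mu>"
  then obtain v where v: "v \<in> carrier_vec m" "v \<noteq> 0\<^sub>v m"
      "Matrix.mat m m (\<lambda>(i, j). f i j) *\<^sub>v v = \<mu> \<cdot>\<^sub>v v"
    by (auto simp: eigenvalue_def eigenvector_def)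
  have "\<exists>i<m. vec_index v i \<noteq> 0"
    using v(1,2) by (auto simp: vec_eq_iff)
  moreover have "(\<Sum>j<m. f i j * vec_index v j) = \<mu> * vec_index v i" if "i < m" for i
    using arg_cong[OF v(3), of "\<lambda>x. vec_index x i"] that v(1)
    by (simp add: scalar_prod_def lessThan_atLeast0)
  ultimately show "\<exists>v. (\<exists>i<m. v i \<noteq> 0) \<and> (\<forall>i<m. (\<Sum>j<m. f i j * v j) = \<mu> * v i)"
    by blast
next
  assume "\<exists>v. (\<exists>i<m. v i \<noteq> 0) \<and> (\<forall>i<m. (\<Sum>j<m. f i j * v j) = \<mu> * v i)"
  then obtain v k where v: "k < m" "v k \<noteq> 0" "\<And>i. i < m \<Longrightarrow> (\<Sum>j<m. f i j * v j) = \<mu> * v i"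
    by blast
  have "eigenvector (Matrix.mat m m (\<lambda>(i, j). f i j)) (Matrix.vec m v) \<mu>"
    unfolding eigenvector_def
    using v by (auto simp: vec_eq_iff scalar_prod_def lessThan_atLeast0)
  then show "eigenvalue (Matrix.mat m m (\<lambda>(i, j). f i j)) \<mu>"
    by (auto simp: eigenvalue_def)
qed

text \<open>Every class modulo constants has exactly one representative of sum zero, and
  \<open>A\<close> preserves the sum-zero hyperplane. So the quotient action is that of
  \<open>A\<close> on this hyperplane.\<close>

lemma eigenvalue_quotient_mat_iff:
  assumes A: "symmetric_stochastic (Suc m) A"
  shows "eigenvalue (quotient_mat m A) \<mu> \<longleftrightarrow>
    (\<exists>u. (\<Sum>i<Suc m. u i) = 0 \<and> (\<exists>i<Suc m. u i \<noteq> 0) \<and>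
      (\<forall>i<Suc m. (\<Sum>j<Suc m. A $$ (i, j) * u j) = \<mu> * u i))"
    (is "_ \<longleftrightarrow> (\<exists>u. ?E u)")
proof
  note A = symmetric_stochasticD[OF A]
  assume "eigenvalue (quotient_mat m A) \<mu>"
  then obtain v k where k: "k < m" "v k \<noteq> 0"
    and v: "\<And>i. i < m \<Longrightarrow> (\<Sum>j<m. (A $$ (Suc i, Suc j) - A $$ (0, Suc j)) * v j) = \<mu> * v i"
    unfolding quotient_mat_def eigenvalue_iff_sum by blast
  \<comment> \<open>Lift \<open>v\<close> with zeroth coordinate 0, then subtract the mean
    \<open>t\<close> to reach the hyperplane. The lift is an eigenvector only up to the constant
    \<open>c\<close>.\<close>
  define w where "w = (\<lambda>i. case i of 0 \<Rightarrow> 0 | Suc i \<Rightarrow> v i)"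
  define t where "t = (\<Sum>i<Suc m. w i) / real (Suc m)"
  define u where "u = (\<lambda>i. w i - t)"
  define c where "c = (\<Sum>j<m. A $$ (0, Suc j) * v j)"
  have "(\<Sum>j<Suc m. A $$ (i, j) * w j) = \<mu> * w i + c" if "i < Suc m" for i
  proof (cases i)
    case 0
    then show ?thesis
      unfolding sum.lessThan_Suc_shift by (simp add: w_def c_def)
  next
    case (Suc i')
    then show ?thesis
      using v[of i'] that unfolding sum.lessThan_Suc_shift
      by (simp add: w_def c_def left_diff_distrib sum_subtractf)
  qed
  then have row: "(\<Sum>j<Suc m. A $$ (i, j) * u j) = \<mu> * u i + (\<mu> * t + c - t)" if "i < Suc m" for i
    using that A(4)[OF that]
    by (simp add: u_def right_diff_distrib sum_subtractf del: sum.lessThan_Suc flip: sum_distrib_right)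
  have u0: "(\<Sum>i<Suc m. u i) = 0"
    by (simp add: u_def t_def sum_subtractf del: sum.lessThan_Suc)
  \<comment> \<open>Sum \<open>row\<close> over all \<open>i\<close>: the image of \<open>u\<close>
    and \<open>u\<close> itself both have sum zero, so the leftover constant vanishes.\<close>
  have "0 = (\<Sum>j<Suc m. (\<Sum>i<Suc m. A $$ (j, i)) * u j)"
    using u0 A(4) by (simp del: sum.lessThan_Suc)
  also have "\<dots> = (\<Sum>j<Suc m. \<Sum>i<Suc m. A $$ (i, j) * u j)"
    unfolding sum_distrib_right using A(2) by (intro sum.cong refl) simp
  also have "\<dots> = (\<Sum>i<Suc m. \<Sum>j<Suc m. A $$ (i, j) * u j)"
    by (rule sum.swap)
  also have "\<dots> = (\<Sum>i<Suc m. \<mu> * u i + (\<mu> * t + c - t))"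
    by (rule sum.cong) (auto simp: row simp del: sum.lessThan_Suc)
  also have "\<dots> = real (Suc m) * (\<mu> * t + c - t)"
    using u0 by (simp add: sum.distrib del: sum.lessThan_Suc flip: sum_distrib_left)
  finally have "\<mu> * t + c - t = 0"
    by simp
  \<comment> \<open>Otherwise \<open>u 0 = - t\<close> would force \<open>t = 0\<close>, and then
    \<open>v k = u (Suc k) = 0\<close>.\<close>
  moreover have "\<exists>i<Suc m. u i \<noteq> 0"
  proof (rule ccontr)
    assume "\<not> (\<exists>i<Suc m. u i \<noteq> 0)"
    then have "u 0 = 0" "u (Suc k) = 0"
      using k(1) by auto
    then show False
      using k(2) by (simp add: u_def w_def)
  qed
  ultimately show "\<exists>u. ?E u"
    using u0 row by (intro exI[of _ u]) (simp del: sum.lessThan_Suc)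
next
  note A = symmetric_stochasticD[OF A]
  assume "\<exists>u. ?E u"
  then obtain u where u0: "(\<Sum>i<Suc m. u i) = 0" and nz: "\<exists>i<Suc m. u i \<noteq> 0"
    and ev: "\<And>i. i < Suc m \<Longrightarrow> (\<Sum>j<Suc m. A $$ (i, j) * u j) = \<mu> * u i"
    by blast
  \<comment> \<open>Subtracting the constant \<open>u 0\<close> keeps the class of \<open>u\<close>
    and removes the zeroth coordinate, which leaves the coordinates in the quotient basis.\<close>
  have ev': "(\<Sum>j<m. A $$ (i, Suc j) * (u (Suc j) - u 0)) = \<mu> * u i - u 0" if "i < Suc m" for i
  proof -
    have "\<mu> * u i - u 0 = (\<Sum>j<Suc m. A $$ (i, j) * u j) - (\<Sum>j<Suc m. A $$ (i, j)) * u 0"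
      using ev A(4) that by simp
    also have "\<dots> = (\<Sum>j<Suc m. A $$ (i, j) * (u j - u 0))"
      by (simp add: sum_distrib_right sum_subtractf right_diff_distrib del: sum.lessThan_Suc)
    finally show ?thesis
      unfolding sum.lessThan_Suc_shift by simp
  qed
  have "(\<Sum>j<m. (A $$ (Suc i, Suc j) - A $$ (0, Suc j)) * (u (Suc j) - u 0)) = \<mu> * (u (Suc i) - u 0)"
    if "i < m" for i
    using ev'[of "Suc i"] ev'[of 0] that
    by (simp add: left_diff_distrib sum_subtractf right_diff_distrib)
  moreover have "\<exists>i<m. u (Suc i) - u 0 \<noteq> 0"
  proof (rule ccontr)
    assume "\<not> ?thesis"
    then have *: "u i = u 0" if "i < Suc m" for i
      using that by (cases i) auto
    have "(\<Sum>i<Suc m. u i) = (\<Sum>i<Suc m. u 0)"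
      by (intro sum.cong refl *) simp
    then have "u 0 = 0"
      using u0 by simp
    then show False
      using nz * by metis
  qed
  ultimately show "eigenvalue (quotient_mat m A) \<mu>"
    unfolding quotient_mat_def eigenvalue_iff_sum
    by (intro exI[of _ "\<lambda>i. u (Suc i) - u 0"]) blast
qed

section \<open>Locating the second eigenvalue in the multiset of roots\<close>

lemma second_largest_nth:
  fixes M :: "'a :: linorder multiset"
  assumes "M \<noteq> {#}" and "\<And>x. x \<in># M \<Longrightarrow> x \<le> y"
  shows "rev (sorted_list_of_multiset (add_mset y M)) ! 1 = Max (set_mset M)"
proof -
  define xs where "xs = sorted_list_of_multiset M"
  have xs: "sorted xs" "mset xs = M" "xs \<noteq> []"
    using assms(1) by (auto simp: xs_def simp flip: mset_zero_iff)
  \<comment> \<open>Since \<open>y\<close> bounds \<open>M\<close>, appending it keeps the list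
    sorted. After reversal it has index 0, and index 1 holds the last entry of \<open>xs\<close>,
    even if \<open>y\<close> also occurs in \<open>M\<close>.\<close>
  have "sorted_list_of_multiset (mset (xs @ [y])) = sort (xs @ [y])"
    by (rule sorted_list_of_multiset_mset)
  also have "sort (xs @ [y]) = xs @ [y]"
    using xs assms(2) by (intro sorted_sort_id) (auto simp: sorted_append)
  finally have "rev (sorted_list_of_multiset (add_mset y M)) ! 1 = last xs"
    using xs by (simp add: rev_nth last_conv_nth Suc_diff_Suc)
  also have "last xs = Max (set xs)"
  proof (rule sym, rule Max_eqI)
    fix x assume "x \<in> set xs"
    then show "x \<le> last xs"
      using xs(1,3) by (cases xs rule: rev_cases) (auto simp: sorted_append)
  qed (use xs(3) in auto)
  finally show ?thesis
    using xs(2) by auto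
qed

lemma char_poly_nonzero: "A \<in> carrier_mat n n \<Longrightarrow> char_poly (A :: 'a :: idom mat) \<noteq> 0"
  by (metis degree_monic_char_poly leading_coeff_0_iff zero_neq_one)

text \<open>The maximum of the Rayleigh quotient is a root of the quotient factor and bounds its
  other roots, as each of them has an eigenvector in the hyperplane. The factor X - 1 adds the root
  1, which is at least as large, so the maximum comes second in the list.\<close>

lemma lambda_2_eigenvector:
  assumes A: "symmetric_stochastic n A" and n: "2 \<le> n"
  obtains u where "(\<Sum>i<n. u i) = 0" "(\<Sum>i<n. (u i)\<^sup>2) = 1"
    "\<And>i. i < n \<Longrightarrow> (\<Sum>j<n. A $$ (i, j) * u j) = lambda 2 A * u i"
    "\<And>v. (\<Sum>i<n. v i) = 0 \<Longrightarrow>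
      (\<Sum>i<n. \<Sum>j<n. A $$ (i, j) * (v i * v j)) \<le> lambda 2 A * (\<Sum>i<n. (v i)\<^sup>2)"
proof (rule max_Rayleigh_quotient_eigenvector[of n "\<lambda>i j. A $$ (i, j)"])
  note A' = symmetric_stochasticD[OF A]
  show "2 \<le> n" "\<And>i j. i < n \<Longrightarrow> j < n \<Longrightarrow> A $$ (i, j) = A $$ (j, i)"
    "\<And>i. i < n \<Longrightarrow> (\<Sum>j<n. A $$ (i, j)) = 1"
    using n A'(2,4) by simp_all
  fix \<mu> u
  assume u0: "(\<Sum>i<n. u i) = 0" and u1: "(\<Sum>i<n. (u i)\<^sup>2) = 1"
    and ev: "\<And>i. i < n \<Longrightarrow> (\<Sum>j<n. A $$ (i, j) * u j) = \<mu> * u i"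
    and max: "\<And>v. (\<Sum>i<n. v i) = 0 \<Longrightarrow>
      (\<Sum>i<n. \<Sum>j<n. A $$ (i, j) * (v i * v j)) \<le> \<mu> * (\<Sum>i<n. (v i)\<^sup>2)"
  have quad: "(\<Sum>i<n. \<Sum>j<n. A $$ (i, j) * (w i * w j)) = e * (\<Sum>i<n. (w i)\<^sup>2)"
    if "\<And>i. i < n \<Longrightarrow> (\<Sum>j<n. A $$ (i, j) * w j) = e * w i" for w e
  proof -
    have "(\<Sum>i<n. \<Sum>j<n. A $$ (i, j) * (w i * w j)) = (\<Sum>i<n. w i * (\<Sum>j<n. A $$ (i, j) * w j))"
      by (simp add: sum_distrib_left mult_ac)
    also have "\<dots> = (\<Sum>i<n. e * (w i)\<^sup>2)"
      by (intro sum.cong) (simp_all add: that power2_eq_square)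
    finally show ?thesis
      by (simp add: sum_distrib_left)
  qed
  \<comment> \<open>Nonnegative entries make the Dirichlet form nonnegative, so \<mu> cannot exceed
    the root 1.\<close>
  have "0 \<le> (\<Sum>i<n. \<Sum>j<n. A $$ (i, j) * (u i - u j)\<^sup>2)"
    using A'(3) by (intro sum_nonneg mult_nonneg_nonneg) auto
  also have "\<dots> = 2 * (1 - \<mu>)"
    using weighted_sum_square_differences[of n "\<lambda>i j. A $$ (i, j)" u, OF A'(2,4)] quad[OF ev] u1
    by simp
  finally have "\<mu> \<le> 1"
    by simp
  obtain m where m: "n = Suc m"
    using n by (cases n) auto
  define M where "M = proots (char_poly (quotient_mat m A))"
  have nz: "char_poly (quotient_mat m A) \<noteq> 0"
    using char_poly_nonzero[OF quotient_mat_carrier] .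
  have M_iff: "e \<in># M \<longleftrightarrow> (\<exists>u. (\<Sum>i<n. u i) = 0 \<and> (\<exists>i<n. u i \<noteq> 0) \<and>
      (\<forall>i<n. (\<Sum>j<n. A $$ (i, j) * u j) = e * u i))" for e
    using eigenvalue_quotient_mat_iff[of m A e] A nz
    unfolding eigenvalue_root_char_poly[OF quotient_mat_carrier] m
    by (simp add: M_def del: sum.lessThan_Suc)
  have "\<exists>i<n. u i \<noteq> 0"
    using u1 by (metis (no_types, lifting) lessThan_iff sum.neutral zero_neq_one zero_power2)
  with u0 ev have \<mu>_in: "\<mu> \<in># M"
    unfolding M_iff by blast
  have le: "e \<le> \<mu>" if "e \<in># M" for e
  proof -
    from that obtain w k where w: "(\<Sum>i<n. w i) = 0" "k < n" "w k \<noteq> 0"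
        "\<And>i. i < n \<Longrightarrow> (\<Sum>j<n. A $$ (i, j) * w j) = e * w i"
      unfolding M_iff by blast
    have "(\<Sum>i<n. (w i)\<^sup>2) > 0"
      using w(2,3) by (intro sum_pos2[of _ k]) auto
    with max[OF w(1)] show ?thesis
      by (simp add: quad[OF w(4)])
  qed
  have "Max (set_mset M) = \<mu>"
    using \<mu>_in le by (intro Max_eqI) auto
  have "char_poly A = [:- 1, 1:] * char_poly (quotient_mat m A)"
    using A'(1,4) unfolding m by (rule char_poly_constant_row_sum)
  then have list: "eigenvalue_list A = rev (sorted_list_of_multiset (add_mset 1 M))"
    using nz by (simp add: eigenvalue_list_def M_def proots_mult del: mult_pCons_left)
  \<comment> \<open>As \<open>M\<close> is nonempty, the list has at least two entries and the
    default value of \<open>lambda\<close> does not occur.\<close>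
  moreover have "length (eigenvalue_list A) = Suc (size M)"
    unfolding list by (metis length_rev mset_sorted_list_of_multiset size_add_mset size_mset)
  moreover have "M \<noteq> {#}" and "\<And>e. e \<in># M \<Longrightarrow> e \<le> 1"
    using \<mu>_in le \<open>\<mu> \<le> 1\<close> by force+
  ultimately have "lambda 2 A = \<mu>"
    using second_largest_nth[of M 1] \<open>Max (set_mset M) = \<mu>\<close>
    by (cases "size M") (auto simp: lambda_def)
  with u0 u1 ev max show thesis
    by (intro that[of u]) simp_all
qed

text \<open>This is the Rayleigh bound seen through the Dirichlet form. The last part, equality at a
  second eigenvector, is what turns a bound on \<open>gamma_sq\<close> into information about
  weights.\<close>

lemma lambda_2_spectral_gap:
  assumes A: "symmetric_stochastic n A" and n: "2 \<le> n"
  shows "lambda 2 A \<le> 1"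
    and "(1 - lambda 2 A) * (\<Sum>i<n. \<Sum>j<n. (v i - v j)\<^sup>2) \<le>
      real n * (\<Sum>i<n. \<Sum>j<n. A $$ (i, j) * (v i - v j)\<^sup>2)"
    and "\<exists>u. (\<Sum>i<n. u i) = 0 \<and> (\<Sum>i<n. (u i)\<^sup>2) = 1 \<and>
      (\<Sum>i<n. \<Sum>j<n. A $$ (i, j) * (u i - u j)\<^sup>2) = 2 * (1 - lambda 2 A)"
proof -
  note A' = symmetric_stochasticD[OF A]
  note energy = weighted_sum_square_differences[of n "\<lambda>i j. A $$ (i, j)", OF A'(2,4)]
  obtain u where u: "(\<Sum>i<n. u i) = 0" "(\<Sum>i<n. (u i)\<^sup>2) = 1"
    and ev: "\<And>i. i < n \<Longrightarrow> (\<Sum>j<n. A $$ (i, j) * u j) = lambda 2 A * u i"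
    and max: "\<And>v. (\<Sum>i<n. v i) = 0 \<Longrightarrow>
      (\<Sum>i<n. \<Sum>j<n. A $$ (i, j) * (v i * v j)) \<le> lambda 2 A * (\<Sum>i<n. (v i)\<^sup>2)"
    using lambda_2_eigenvector[OF assms] by blast
  have "(\<Sum>i<n. \<Sum>j<n. A $$ (i, j) * (u i * u j)) = (\<Sum>i<n. u i * (\<Sum>j<n. A $$ (i, j) * u j))"
    by (simp add: sum_distrib_left mult_ac)
  also have "\<dots> = (\<Sum>i<n. lambda 2 A * (u i)\<^sup>2)"
    by (intro sum.cong) (simp_all add: ev power2_eq_square)
  finally have eu: "(\<Sum>i<n. \<Sum>j<n. A $$ (i, j) * (u i - u j)\<^sup>2) = 2 * (1 - lambda 2 A)"
    using u(2) energy[of u] by (simp flip: sum_distrib_left)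
  with u show "\<exists>u. (\<Sum>i<n. u i) = 0 \<and> (\<Sum>i<n. (u i)\<^sup>2) = 1 \<and>
      (\<Sum>i<n. \<Sum>j<n. A $$ (i, j) * (u i - u j)\<^sup>2) = 2 * (1 - lambda 2 A)"
    by blast
  have "0 \<le> (\<Sum>i<n. \<Sum>j<n. A $$ (i, j) * (u i - u j)\<^sup>2)"
    using A'(3) by (intro sum_nonneg mult_nonneg_nonneg) auto
  then show "lambda 2 A \<le> 1"
    by (simp add: eu)
  \<comment> \<open>Subtracting the mean brings \<open>v\<close> into the hyperplane without
    changing differences.\<close>
  define w where "w = (\<lambda>i. v i - (\<Sum>i<n. v i) / real n)"
  have w0: "(\<Sum>i<n. w i) = 0"
    using n by (simp add: w_def sum_subtractf)
  have "(1 - lambda 2 A) * (\<Sum>i<n. \<Sum>j<n. (w i - w j)\<^sup>2) =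
      2 * real n * ((\<Sum>i<n. (w i)\<^sup>2) - lambda 2 A * (\<Sum>i<n. (w i)\<^sup>2))"
    by (simp add: sum_square_differences w0 algebra_simps)
  also have "\<dots> \<le> 2 * real n * ((\<Sum>i<n. (w i)\<^sup>2) - (\<Sum>i<n. \<Sum>j<n. A $$ (i, j) * (w i * w j)))"
    using max[OF w0] by (intro mult_left_mono) auto
  also have "\<dots> = real n * (\<Sum>i<n. \<Sum>j<n. A $$ (i, j) * (w i - w j)\<^sup>2)"
    by (simp add: energy)
  finally show "(1 - lambda 2 A) * (\<Sum>i<n. \<Sum>j<n. (v i - v j)\<^sup>2) \<le>
      real n * (\<Sum>i<n. \<Sum>j<n. A $$ (i, j) * (v i - v j)\<^sup>2)"
    by (simp add: w_def)
qed

section \<open>Positive semidefinite kernels\<close>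

text \<open>Test the form on a combination of two unit vectors; for \<open>i = j\<close> the
  coefficients add up.\<close>

lemma psd_two_point:
  fixes G :: "nat \<Rightarrow> nat \<Rightarrow> real"
  assumes psd: "\<And>c. 0 \<le> (\<Sum>i<n. \<Sum>j<n. G i j * (c i * c j))"
    and sym: "G i j = G j i" and ij: "i < n" "j < n"
  shows "0 \<le> s\<^sup>2 * G i i + 2 * s * t * G i j + t\<^sup>2 * G j j"
proof -
  define c where "c = (\<lambda>k. (if k = i then s else 0) + (if k = j then t else 0))"
  have lin: "(\<Sum>k<n. f k * c k) = f i * s + f j * t" for f
  proof -
    have "f k * c k = (if k = i then f k * s else 0) + (if k = j then f k * t else 0)" for k
      by (simp add: c_def distrib_left)
    then show ?thesis
      using ij by (simp add: sum.distrib)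
  qed
  have "(\<Sum>k<n. \<Sum>l<n. G k l * (c k * c l)) = (\<Sum>k<n. (\<Sum>l<n. G k l * c l) * c k)"
    by (simp add: sum_distrib_left sum_distrib_right mult_ac)
  also have "\<dots> = s\<^sup>2 * G i i + 2 * s * t * G i j + t\<^sup>2 * G j j"
    unfolding lin by (simp add: sym power2_eq_square algebra_simps)
  finally show ?thesis
    using psd[of c] by simp
qed

text \<open>Cholesky elimination: a rank-one kernel built from \<open>r\<close> matches the last row
  and column, and subtracting it leaves the Schur complement, a positive semidefinite kernel on one
  index fewer.\<close>

lemma psd_factorization:
  fixes G :: "nat \<Rightarrow> nat \<Rightarrow> real"
  assumes "\<And>i j. i < n \<Longrightarrow> j < n \<Longrightarrow> G i j = G j i"
    and "\<And>c. 0 \<le> (\<Sum>i<n. \<Sum>j<n. G i j * (c i * c j))"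
  shows "\<exists>F. \<forall>i<n. \<forall>j<n. G i j = (\<Sum>k<n. F k i * F k j)"
  using assms
proof (induction n arbitrary: G)
  case 0
  then show ?case by simp
next
  case (Suc n)
  note two_point = psd_two_point[OF Suc.prems(2) Suc.prems(1)]
  \<comment> \<open>If \<open>G n n = 0\<close>, division by zero gives \<open>r = 0\<close>, in
    accordance with the last column, which then vanishes.\<close>
  define r where "r = (\<lambda>i. G i n / sqrt (G n n))"
  have Gnn: "0 \<le> G n n"
    using two_point[of n n 1 0] by simp
  have Gin: "G i n = r i * r n" if i: "i < Suc n" for i
  proof (cases "G n n = 0")
    case True
    have "G i n = 0"
    proof (rule ccontr)
      assume "G i n \<noteq> 0"
      \<comment> \<open>With \<open>G n n = 0\<close> the two-point form is affine in
        \<open>t\<close>; this value of \<open>t\<close> makes it -1.\<close>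
      then have "2 * 1 * (- (G i i + 1) / (2 * G i n)) * G i n = - (G i i + 1)"
        by simp
      then show False
        using two_point[of i n 1 "- (G i i + 1) / (2 * G i n)"] i True
        by (simp del: times_divide_eq_left times_divide_eq_right)
    qed
    then show ?thesis
      by (simp add: r_def True)
  next
    case False
    then show ?thesis
      using Gnn by (simp add: r_def)
  qed
  have "\<exists>F. \<forall>i<n. \<forall>j<n. G i j - r i * r j = (\<Sum>k<n. F k i * F k j)"
  proof (rule Suc.IH)
    show "G i j - r i * r j = G j i - r j * r i" if "i < n" "j < n" for i j
      using Suc.prems(1)[of i j] that by simp
    fix c :: "nat \<Rightarrow> real"
    define \<rho> where "\<rho> = (\<Sum>i<n. r i * c i)"
    \<comment> \<open>This last coordinate minimizes the full form, and the minimum is the form of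
      the Schur complement at \<open>c\<close>.\<close>
    define x where "x = - \<rho> / r n"
    have "r n = 0 \<Longrightarrow> \<rho> = 0"
      using Gnn by (auto simp: r_def \<rho>_def)
    then have x: "2 * x * (r n * \<rho>) + (r n * x)\<^sup>2 = - \<rho>\<^sup>2"
      by (cases "r n = 0") (auto simp: x_def power2_eq_square)
    have "0 \<le> (\<Sum>i<Suc n. \<Sum>j<Suc n. G i j * ((c(n := x)) i * (c(n := x)) j))"
      by (rule Suc.prems(2))
    also have "\<dots> = (\<Sum>i<n. \<Sum>j<n. G i j * (c i * c j)) + (\<Sum>i<n. G i n * (c i * x))
        + (\<Sum>j<n. G n j * (x * c j)) + G n n * (x * x)"
      by (simp add: sum.distrib)
    also have "(\<Sum>j<n. G n j * (x * c j)) = (\<Sum>i<n. G i n * (c i * x))"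
      by (intro sum.cong refl) (simp add: Suc.prems(1)[of n])
    also have "(\<Sum>i<n. G i n * (c i * x)) = x * (r n * \<rho>)"
      by (simp add: \<rho>_def sum_distrib_left Gin mult_ac)
    also have "G n n * (x * x) = (r n * x)\<^sup>2"
      by (simp add: Gin power2_eq_square)
    finally have "0 \<le> (\<Sum>i<n. \<Sum>j<n. G i j * (c i * c j)) - \<rho>\<^sup>2"
      using x by (simp add: mult_ac)
    also have "\<rho>\<^sup>2 = (\<Sum>i<n. \<Sum>j<n. r i * r j * (c i * c j))"
      by (simp add: \<rho>_def power2_eq_square sum_product mult_ac)
    finally show "0 \<le> (\<Sum>i<n. \<Sum>j<n. (G i j - r i * r j) * (c i * c j))"
      by (simp add: left_diff_distrib sum_subtractf)
  qed
  then obtain F where F: "\<And>i j. i < n \<Longrightarrow> j < n \<Longrightarrow> G i j - r i * r j = (\<Sum>k<n. F k i * F k j)"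
    by blast
  define F' where "F' = (\<lambda>k i. if k = n then r i else if i = n then 0 else F k i)"
  have "G i j = (\<Sum>k<Suc n. F' k i * F' k j)" if "i < Suc n" "j < Suc n" for i j
  proof (cases "i = n \<or> j = n")
    case True
    then have "(\<Sum>k<n. F' k i * F' k j) = 0"
      by (intro sum.neutral) (auto simp: F'_def)
    moreover have "G i j = r i * r j"
      using True Gin that Suc.prems(1)[of n j] by (auto simp: mult.commute)
    ultimately show ?thesis
      by (simp add: F'_def)
  next
    case False
    then have "(\<Sum>k<n. F' k i * F' k j) = (\<Sum>k<n. F k i * F k j)"
      by (intro sum.cong) (auto simp: F'_def)
    then show ?thesis
      using F[of i j] False that by (simp add: F'_def)
  qed
  then show ?case
    by blast
qed

text \<open>A minimax argument: at a minimizer \<open>G\<close> of the squared violation of the constraints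
  \<open>G i i + G j j - 2 * G i j \<le> q i j\<close>, the violations themselves serve as the weights in the
  hypothesis, and moving towards the rank-one kernel supplied for these weights would decrease
  the violation to first order.\<close>

lemma psd_dominated_by_duality:
  fixes q :: "nat \<Rightarrow> nat \<Rightarrow> real"
  assumes sym_q: "\<And>i j. i < n \<Longrightarrow> j < n \<Longrightarrow> q i j = q j i"
    and diag_q: "\<And>i. i < n \<Longrightarrow> q i i = 0"
    and s: "0 \<le> s"
    and dual: "\<And>w. (\<And>i j. i < n \<Longrightarrow> j < n \<Longrightarrow> 0 \<le> w i j) \<Longrightarrow>
      (\<And>i j. i < n \<Longrightarrow> j < n \<Longrightarrow> w i j = w j i) \<Longrightarrow> (\<And>i. i < n \<Longrightarrow> w i i = 0) \<Longrightarrow>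
      \<exists>u. (\<Sum>i<n. u i) = 0 \<and> (\<Sum>i<n. (u i)\<^sup>2) = 1 \<and>
        s * (\<Sum>i<n. \<Sum>j<n. w i j * (u i - u j)\<^sup>2) \<le> (\<Sum>i<n. \<Sum>j<n. w i j * q i j)"
  shows "\<exists>G. (\<forall>i<n. \<forall>j<n. G i j = G j i) \<and>
    (\<forall>c. 0 \<le> (\<Sum>i<n. \<Sum>j<n. G i j * (c i * c j))) \<and>
    (\<Sum>i<n. \<Sum>j<n. G i j) = 0 \<and> (\<Sum>i<n. G i i) = s \<and>
    (\<forall>i<n. \<forall>j<n. G i i + G j j - 2 * G i j \<le> q i j)"
proof -
  \<comment> \<open>For a Gram kernel \<open>G\<close> these are the squared distances between the
    embedded points.\<close>
  define M where "M = (\<lambda>(G :: nat \<times> nat \<Rightarrow> real) i j. G (i, i) + G (j, j) - 2 * G (i, j))"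
  \<comment> \<open>A compact convex set of kernels: total sum 0 places the centre of mass of the
    embedded points at the origin, and the trace fixes the scale.\<close>
  define T where "T = {G :: nat \<times> nat \<Rightarrow> real. \<forall>p. G p \<in> {- s..s}} \<inter>
    (\<Inter>i\<in>{..<n}. \<Inter>j\<in>{..<n}. {G. G (i, j) = G (j, i)}) \<inter>
    (\<Inter>c. {G. 0 \<le> (\<Sum>i<n. \<Sum>j<n. G (i, j) * (c i * c j))}) \<inter>
    {G. (\<Sum>i<n. \<Sum>j<n. G (i, j)) = 0} \<inter> {G. (\<Sum>i<n. G (i, i)) = s}"
  define \<Phi> where "\<Phi> = (\<lambda>G. \<Sum>i<n. \<Sum>j<n. (max 0 (M G i j - q i j))\<^sup>2)"
  have coord: "continuous_on S (\<lambda>G :: nat \<times> nat \<Rightarrow> real. G p)" for S p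
    by (rule continuous_on_subset[OF continuous_on_product_coordinates]) simp
  have "compact T"
    unfolding T_def Int_assoc
    by (intro compact_Int_closed compact_cube closed_Int closed_INT ballI
        closed_Collect_eq closed_Collect_le continuous_intros coord)
  \<comment> \<open>The kernel of the embedding into the line by a multiple of \<open>u\<close>. It
    shows that \<open>T\<close> is nonempty and later serves as the competitor
    \<open>H\<close>.\<close>
  have rank_one: "(\<lambda>(i, j). if i < n \<and> j < n then s * (u i * u j) else 0) \<in> T"
    if u: "(\<Sum>i<n. u i) = 0" "(\<Sum>i<n. (u i)\<^sup>2) = 1" for u
  proof -
    have "\<bar>u i\<bar> \<le> 1" if "i < n" for i
    proof -
      have "(u i)\<^sup>2 \<le> 1"
        using that unfolding u(2)[symmetric] by (intro member_le_sum) auto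
      then show ?thesis
        by (simp add: abs_square_le_1)
    qed
    then have "\<bar>u i * u j\<bar> \<le> 1" if "i < n" "j < n" for i j
      using that by (simp add: abs_mult mult_le_one)
    then have "\<bar>s * (u i * u j)\<bar> \<le> s" if "i < n" "j < n" for i j
      using that s by (simp add: abs_mult mult_left_le)
    then have 1: "s * (u i * u j) \<in> {- s..s}" if "i < n" "j < n" for i j
      using that by (simp add: abs_le_iff minus_le_iff)
    have "(\<Sum>i<n. \<Sum>j<n. s * (u i * u j) * (c i * c j)) = s * (\<Sum>i<n. u i * c i)\<^sup>2" for c
      by (simp add: power2_eq_square sum_product sum_distrib_left mult_ac)
    then have 2: "0 \<le> (\<Sum>i<n. \<Sum>j<n. s * (u i * u j) * (c i * c j))" for c
      using s by simp
    have "(\<Sum>i<n. \<Sum>j<n. s * (u i * u j)) = s * (\<Sum>i<n. u i)\<^sup>2"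
      unfolding power2_eq_square sum_product by (simp add: sum_distrib_left)
    moreover have "(\<Sum>i<n. s * (u i * u i)) = s"
      using u(2) by (simp add: power2_eq_square flip: sum_distrib_left)
    ultimately show ?thesis
      using 1 2 s u(1) by (auto simp: T_def)
  qed
  have "T \<noteq> {}"
    using dual[of "\<lambda>i j. 0"] rank_one by auto
  moreover have "continuous_on T \<Phi>"
    unfolding \<Phi>_def M_def by (intro continuous_intros coord)
  ultimately obtain G where G: "G \<in> T" and min: "\<And>H. H \<in> T \<Longrightarrow> \<Phi> G \<le> \<Phi> H"
    using continuous_attains_inf[OF \<open>compact T\<close>] by metis
  define w where "w = (\<lambda>i j. max 0 (M G i j - q i j))"
  have w: "0 \<le> w i j" for i j
    by (simp add: w_def)
  have "w i j = w j i" if "i < n" "j < n" for i j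
    using that G sym_q[OF that] by (auto simp: w_def M_def T_def)
  moreover have "w i i = 0" if "i < n" for i
    using that diag_q[OF that] by (auto simp: w_def M_def)
  ultimately obtain u where u: "(\<Sum>i<n. u i) = 0" "(\<Sum>i<n. (u i)\<^sup>2) = 1"
    and uw: "s * (\<Sum>i<n. \<Sum>j<n. w i j * (u i - u j)\<^sup>2) \<le> (\<Sum>i<n. \<Sum>j<n. w i j * q i j)"
    using dual[of w] w by blast
  define H where "H = (\<lambda>(i, j). if i < n \<and> j < n then s * (u i * u j) else 0)"
  have H: "H \<in> T"
    unfolding H_def by (rule rank_one[OF u])
  define \<delta> where "\<delta> = (\<lambda>i j. M H i j - M G i j)"
  have MH: "M H i j = s * (u i - u j)\<^sup>2" if "i < n" "j < n" for i j
    using that by (simp add: M_def H_def power2_eq_square algebra_simps)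
  have "0 \<le> (\<Sum>i<n. \<Sum>j<n. w i j * \<delta> i j)"
  proof (rule first_order_nonneg)
    fix t :: real
    assume t: "0 < t" "t \<le> 1"
    define I where "I = (\<lambda>p. (1 - t) * G p + t * H p)"
    have "I \<in> T"
    proof -
      have "I p \<in> {- s..s}" for p
      proof -
        have "G p \<in> {- s..s}" "H p \<in> {- s..s}"
          using G H by (cases p, simp add: T_def)+
        then show ?thesis
          using t convexD_alt[of "{- s..s}" "G p" "H p" t] by (simp add: I_def)
      qed
      moreover have "I (i, j) = I (j, i)" if "i < n" "j < n" for i j
        using G H that by (auto simp: T_def I_def)
      moreover have I_sum: "(\<Sum>i<n. \<Sum>j<n. I (i, j) * (c i j)) =
          (1 - t) * (\<Sum>i<n. \<Sum>j<n. G (i, j) * c i j) + t * (\<Sum>i<n. \<Sum>j<n. H (i, j) * c i j)" for c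
        by (simp add: I_def sum.distrib distrib_right sum_distrib_left mult.assoc)
      moreover have "0 \<le> (\<Sum>i<n. \<Sum>j<n. I (i, j) * (c i * c j))" for c
        unfolding I_sum using t G H by (intro add_nonneg_nonneg mult_nonneg_nonneg) (auto simp: T_def)
      moreover have "(\<Sum>i<n. \<Sum>j<n. I (i, j)) = 0"
        using I_sum[of "\<lambda>i j. 1"] G H by (simp add: T_def)
      moreover have "(\<Sum>i<n. I (i, i)) = s"
      proof -
        have "(\<Sum>i<n. I (i, i)) = (1 - t) * (\<Sum>i<n. G (i, i)) + t * (\<Sum>i<n. H (i, i))"
          by (simp add: I_def sum.distrib sum_distrib_left)
        also have "\<dots> = (1 - t) * s + t * s"
          using G H by (simp add: T_def)
        finally show ?thesis
          by (simp add: algebra_simps)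
      qed
      ultimately show ?thesis
        by (auto simp: T_def)
    qed
    \<comment> \<open>A quadratic upper bound for the squared positive part, in place of its
      derivative.\<close>
    have square: "(max 0 (a + h))\<^sup>2 \<le> (max 0 a)\<^sup>2 + 2 * h * max 0 a + h\<^sup>2" for a h :: real
    proof -
      have "(max 0 (a + h))\<^sup>2 \<le> (max 0 a + h)\<^sup>2"
        by (auto simp: max_def intro: power_mono)
      then show ?thesis
        by (simp add: power2_sum mult_ac)
    qed
    have shift: "M I i j - q i j = (M G i j - q i j) + t * \<delta> i j" for i j
      by (simp add: M_def I_def \<delta>_def algebra_simps)
    have "(max 0 (M I i j - q i j))\<^sup>2 \<le> (w i j)\<^sup>2 + 2 * (t * \<delta> i j) * w i j + (t * \<delta> i j)\<^sup>2" for i j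
      unfolding shift w_def by (rule square)
    then have "\<Phi> I \<le> (\<Sum>i<n. \<Sum>j<n. (w i j)\<^sup>2 + 2 * (t * \<delta> i j) * w i j + (t * \<delta> i j)\<^sup>2)"
      unfolding \<Phi>_def by (intro sum_mono)
    also have "\<dots> = \<Phi> G + 2 * t * (\<Sum>i<n. \<Sum>j<n. w i j * \<delta> i j) + t\<^sup>2 * (\<Sum>i<n. \<Sum>j<n. (\<delta> i j)\<^sup>2)"
      by (simp add: \<Phi>_def w_def sum.distrib sum_distrib_left power_mult_distrib mult_ac)
    finally show "0 \<le> 2 * t * (\<Sum>i<n. \<Sum>j<n. w i j * \<delta> i j) + t\<^sup>2 * (\<Sum>i<n. \<Sum>j<n. (\<delta> i j)\<^sup>2)"
      using min[OF \<open>I \<in> T\<close>] by simp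
  qed
  also have "(\<Sum>i<n. \<Sum>j<n. w i j * \<delta> i j) =
      s * (\<Sum>i<n. \<Sum>j<n. w i j * (u i - u j)\<^sup>2) - (\<Sum>i<n. \<Sum>j<n. w i j * M G i j)"
    by (simp add: \<delta>_def MH right_diff_distrib sum_subtractf sum_distrib_left mult_ac)
  also have "\<dots> \<le> (\<Sum>i<n. \<Sum>j<n. w i j * q i j) - (\<Sum>i<n. \<Sum>j<n. w i j * M G i j)"
    using uw by simp
  \<comment> \<open>Where \<open>w i j\<close> is nonzero it equals \<open>M G i j - q i j\<close>.
    So a nonnegative number is at most minus the sum of the squared violations, and all of these
    vanish.\<close>
  also have "\<dots> = (\<Sum>i<n. \<Sum>j<n. - (w i j)\<^sup>2)"
    unfolding sum_subtractf[symmetric]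
    by (intro sum.cong refl) (auto simp: w_def max_def power2_eq_square algebra_simps)
  finally have "(\<Sum>i<n. \<Sum>j<n. (w i j)\<^sup>2) \<le> 0"
    by (simp add: sum_negf)
  then have "(\<Sum>i<n. \<Sum>j<n. (w i j)\<^sup>2) = 0"
    by (intro antisym sum_nonneg) auto
  then have w0: "w i j = 0" if "i < n" "j < n" for i j
    using that by (simp add: sum_nonneg_eq_0_iff sum_nonneg)
  have "M G i j \<le> q i j" if "i < n" "j < n" for i j
    using w0[OF that] by (simp add: w_def max_def split: if_splits)
  with G show ?thesis
    by (intro exI[of _ "\<lambda>i j. G (i, j)"]) (auto simp: T_def M_def)
qed

section \<open>Lipschitz maps into \<open>\<ell>\<^sub>2\<close>\<close>

lemma ell2_diff:
  assumes "u \<in> ell2" "v \<in> ell2"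
  shows "u - v \<in> ell2"
proof -
  have "summable (\<lambda>k. 2 * (u k)\<^sup>2 + 2 * (v k)\<^sup>2)"
    using assms by (intro summable_add summable_mult) (auto simp: ell2_def)
  moreover have "norm ((u k - v k)\<^sup>2) \<le> 2 * (u k)\<^sup>2 + 2 * (v k)\<^sup>2" for k
    using zero_le_power2[of "u k + v k"] unfolding real_norm_def abs_power2
    by (simp add: power2_sum power2_diff)
  ultimately have "summable (\<lambda>k. (u k - v k)\<^sup>2)"
    by (rule summable_comparison_test'[where N = 0])
  then show ?thesis
    by (simp add: ell2_def)
qed

lemma ell2_norm_nonneg: "u \<in> ell2 \<Longrightarrow> 0 \<le> ell2_norm u"
  by (simp add: ell2_def ell2_norm_def suminf_nonneg)

lemma ell2_norm_sums: "u \<in> ell2 \<Longrightarrow> (\<lambda>k. (u k)\<^sup>2) sums (ell2_norm u)\<^sup>2"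
  by (simp add: ell2_def ell2_norm_def suminf_nonneg summable_sums)

lemma ell2_norm_pos:
  assumes "u \<in> ell2" "u k \<noteq> 0"
  shows "0 < ell2_norm u"
proof -
  have "0 < (\<Sum>k. (u k)\<^sup>2)"
    using assms by (intro suminf_pos2[of _ k]) (auto simp: ell2_def)
  then show ?thesis
    by (simp add: ell2_norm_def)
qed

lemma finite_support_ell2:
  assumes "\<And>k. n \<le> k \<Longrightarrow> u k = 0"
  shows "u \<in> ell2" and "(ell2_norm u)\<^sup>2 = (\<Sum>k<n. (u k)\<^sup>2)"
proof -
  have *: "(\<lambda>k. (u k)\<^sup>2) sums (\<Sum>k<n. (u k)\<^sup>2)"
    using assms by (intro sums_finite) (auto simp: not_less)
  then show "u \<in> ell2"
    by (auto simp: ell2_def sums_iff)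
  then show "(ell2_norm u)\<^sup>2 = (\<Sum>k<n. (u k)\<^sup>2)"
    using * ell2_norm_sums sums_unique2 by blast
qed

lemma lip_norm_le:
  assumes "0 \<le> L" "\<And>p q. p \<in> S \<Longrightarrow> q \<in> S \<Longrightarrow> ell2_norm (f p - f q) \<le> L * d p q"
  shows "lip_norm d S f \<le> L"
  unfolding lip_norm_def using assms by (intro cInf_lower bdd_belowI[of _ 0]) auto

text \<open>Finiteness of \<open>S\<close> provides some Lipschitz constant, and the condition on
  \<open>L\<close> is closed, so the infimum is itself a Lipschitz constant.\<close>

lemma lip_norm:
  assumes d: "Metric_space X d" and S: "finite S" "S \<subseteq> X" and f: "f ` S \<subseteq> ell2"
  shows lip_norm_nonneg: "0 \<le> lip_norm d S f"
    and ell2_norm_diff_le: "\<And>p q. p \<in> S \<Longrightarrow> q \<in> S \<Longrightarrow> ell2_norm (f p - f q) \<le> lip_norm d S f * d p q"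
proof -
  interpret Metric_space X d by fact
  define N where "N = (\<lambda>p q. ell2_norm (f p - f q))"
  define \<L> where "\<L> = {L. 0 \<le> L \<and> (\<forall>p\<in>S. \<forall>q\<in>S. N p q \<le> L * d p q)}"
  have N: "0 \<le> N p q" if "p \<in> S" "q \<in> S" for p q
    using that f by (auto simp: N_def intro!: ell2_norm_nonneg ell2_diff)
  have N0: "N p p = 0" for p
    by (simp add: N_def ell2_norm_def)
  \<comment> \<open>A crude Lipschitz constant: the sum of all difference quotients, where those
    with \<open>p = q\<close> are 0 / 0 = 0.\<close>
  define L where "L = (\<Sum>p\<in>S. \<Sum>q\<in>S. N p q / d p q)"
  have terms: "0 \<le> N p q / d p q" if "p \<in> S" "q \<in> S" for p q
    using N that by simp
  have "N p q \<le> L * d p q" if pq: "p \<in> S" "q \<in> S" for p q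
  proof (cases "p = q")
    case True
    then show ?thesis
      using pq S by (auto simp: N0 subset_iff)
  next
    case False
    then have "d p q > 0"
      using pq S by (metis mdist_pos_less subsetD)
    moreover have "N p q / d p q \<le> (\<Sum>q\<in>S. N p q / d p q)"
      using terms pq S by (intro member_le_sum) auto
    moreover have "\<dots> \<le> L"
      unfolding L_def using terms pq S
      by (intro member_le_sum[of p S "\<lambda>p. \<Sum>q\<in>S. N p q / d p q"] sum_nonneg) auto
    ultimately have "0 < d p q" "N p q / d p q \<le> L"
      by simp_all
    then show ?thesis
      by (simp add: pos_divide_le_eq)
  qed
  moreover have "0 \<le> L"
    unfolding L_def using terms by (intro sum_nonneg)
  ultimately have ne: "\<L> \<noteq> {}"
    by (auto simp: \<L>_def)
  have eq: "lip_norm d S f = Inf \<L>"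
    by (simp add: lip_norm_def \<L>_def N_def)
  show "0 \<le> lip_norm d S f"
    unfolding eq using ne by (intro cInf_greatest) (auto simp: \<L>_def)
  fix p q assume pq: "p \<in> S" "q \<in> S"
  have "N p q \<le> Inf \<L> * d p q"
  proof (cases "p = q")
    case True
    then show ?thesis
      using pq S by (auto simp: N0 subset_iff)
  next
    case False
    then have pos: "d p q > 0"
      using pq S by (metis mdist_pos_less subsetD)
    have "N p q / d p q \<le> Inf \<L>"
      using ne pq pos by (intro cInf_greatest) (auto simp: \<L>_def pos_divide_le_eq)
    then show ?thesis
      using pos by (simp add: pos_divide_le_eq)
  qed
  then show "ell2_norm (f p - f q) \<le> lip_norm d S f * d p q"
    by (simp add: eq N_def)
qed

section \<open>Spectral gaps and embeddings\<close>

text \<open>Serves two limits: from all \<open>D > K\<close> to \<open>K\<close>, and from the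
  numbers above a bound on the infimum \<open>gamma_sq\<close> to that bound.\<close>

lemma le_mult_if_le_mult_greater:
  fixes a b c :: real
  assumes "0 \<le> b" and le: "\<And>c'. c < c' \<Longrightarrow> a \<le> c' * b"
  shows "a \<le> c * b"
proof (cases "b = 0")
  case True
  then show ?thesis
    using le[of "c + 1"] by simp
next
  case False
  then have "b > 0"
    using \<open>0 \<le> b\<close> by simp
  then have "a / b \<le> c'" if "c < c'" for c'
    using le[OF that] by (simp add: pos_divide_le_eq)
  then have "a / b \<le> c"
    by (rule dense_ge)
  then show ?thesis
    using \<open>b > 0\<close> by (simp add: pos_divide_le_eq)
qed

lemma poincare_inequality_ell2:
  assumes A: "symmetric_stochastic n A" and n: "2 \<le> n" and g: "\<And>i. i < n \<Longrightarrow> g i \<in> ell2"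
  shows "(1 - lambda 2 A) * (\<Sum>i<n. \<Sum>j<n. (ell2_norm (g i - g j))\<^sup>2) \<le>
    real n * (\<Sum>i<n. \<Sum>j<n. A $$ (i, j) * (ell2_norm (g i - g j))\<^sup>2)"
proof (rule sums_le)
  have *: "(\<lambda>k. (g i k - g j k)\<^sup>2) sums (ell2_norm (g i - g j))\<^sup>2" if "i < n" "j < n" for i j
    using ell2_norm_sums[OF ell2_diff[OF g[OF that(1)] g[OF that(2)]]] by simp
  show "(\<lambda>k. (1 - lambda 2 A) * (\<Sum>i<n. \<Sum>j<n. (g i k - g j k)\<^sup>2)) sums
      ((1 - lambda 2 A) * (\<Sum>i<n. \<Sum>j<n. (ell2_norm (g i - g j))\<^sup>2))"
    by (intro sums_mult sums_sum *) auto
  show "(\<lambda>k. real n * (\<Sum>i<n. \<Sum>j<n. A $$ (i, j) * (g i k - g j k)\<^sup>2)) sums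
      (real n * (\<Sum>i<n. \<Sum>j<n. A $$ (i, j) * (ell2_norm (g i - g j))\<^sup>2))"
    by (intro sums_mult sums_sum *) auto
  show "(1 - lambda 2 A) * (\<Sum>i<n. \<Sum>j<n. (g i k - g j k)\<^sup>2) \<le>
      real n * (\<Sum>i<n. \<Sum>j<n. A $$ (i, j) * (g i k - g j k)\<^sup>2)" for k
    using lambda_2_spectral_gap(2)[OF A n] .
qed

text \<open>The characteristic polynomial has degree 1, so the list of eigenvalues is too short and
  the default value applies. This covers \<open>n = 1\<close>, where the sum-zero hyperplane is
  trivial.\<close>

lemma lambda_2_singleton:
  assumes "A \<in> carrier_mat 1 1"
  shows "lambda 2 A = 0"
proof -
  have "length (eigenvalue_list A) = size (proots (char_poly A))"
    unfolding eigenvalue_list_def by (metis length_rev mset_sorted_list_of_multiset size_mset)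
  also have "\<dots> \<le> degree (char_poly A)"
    by (rule size_proots_le)
  also have "\<dots> = 1"
    using degree_monic_char_poly[OF assms] by simp
  finally show ?thesis
    by (simp add: lambda_def)
qed

text \<open>Any \<open>c'\<close> above \<open>c\<close> exceeds some finite admissible
  \<open>g\<close>; as the weighted sum is nonnegative, \<open>c'\<close> satisfies the inequality
  too. Then let \<open>c'\<close> decrease to \<open>c\<close>.\<close>

lemma gamma_sqD:
  assumes gamma: "gamma_sq n A X d \<le> ereal c" and n: "1 \<le> n" and x: "x ` {..<n} \<subseteq> X"
    and nonneg: "\<And>i j. i < n \<Longrightarrow> j < n \<Longrightarrow> 0 \<le> A $$ (i, j)"
  shows "(\<Sum>i<n. \<Sum>j<n. (d (x i) (x j))\<^sup>2) \<le>
    c * (real n * (\<Sum>i<n. \<Sum>j<n. A $$ (i, j) * (d (x i) (x j))\<^sup>2))"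
proof (rule le_mult_if_le_mult_greater)
  define E where "E = (\<Sum>i<n. \<Sum>j<n. A $$ (i, j) * (d (x i) (x j))\<^sup>2)"
  have E: "0 \<le> E"
    unfolding E_def using nonneg by (intro sum_nonneg mult_nonneg_nonneg) auto
  then show "0 \<le> real n * (\<Sum>i<n. \<Sum>j<n. A $$ (i, j) * (d (x i) (x j))\<^sup>2)"
    by (simp add: E_def)
  fix c' assume "c < c'"
  then have "gamma_sq n A X d < ereal c'"
    using gamma by (meson less_ereal.simps(1) order_le_less_trans)
  then obtain g where g: "0 < g" "g < ereal c'"
    and le: "ereal (1 / (real n)\<^sup>2 * (\<Sum>i<n. \<Sum>j<n. (d (x i) (x j))\<^sup>2)) \<le> g / ereal (real n) * ereal E"
    using x unfolding gamma_sq_def Inf_less_iff E_def by blast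
  obtain r where r: "g = ereal r"
    using g by (cases g) auto
  have "1 / (real n)\<^sup>2 * (\<Sum>i<n. \<Sum>j<n. (d (x i) (x j))\<^sup>2) \<le> r / real n * E"
    using le n by (simp add: r)
  then have "(\<Sum>i<n. \<Sum>j<n. (d (x i) (x j))\<^sup>2) \<le> r * (real n * E)"
    using n by (simp add: field_simps power2_eq_square)
  also have "\<dots> \<le> c' * (real n * E)"
    using g E r by (intro mult_right_mono) auto
  finally show "(\<Sum>i<n. \<Sum>j<n. (d (x i) (x j))\<^sup>2) \<le>
      c' * (real n * (\<Sum>i<n. \<Sum>j<n. A $$ (i, j) * (d (x i) (x j))\<^sup>2))"
    by (simp add: E_def)
qed

text \<open>The matrix is I - \<epsilon> L with the graph Laplacian L of the weights. Functions
  \<open>h\<close> that vanish on the diagonal do not see the mass placed there to complete the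
  rows.\<close>

lemma symmetric_stochastic_of_weights:
  fixes w :: "nat \<Rightarrow> nat \<Rightarrow> real"
  assumes nonneg: "\<And>i j. i < n \<Longrightarrow> j < n \<Longrightarrow> 0 \<le> w i j"
    and sym: "\<And>i j. i < n \<Longrightarrow> j < n \<Longrightarrow> w i j = w j i"
  shows "\<exists>A \<epsilon>. symmetric_stochastic n A \<and> 0 < \<epsilon> \<and>
    (\<forall>h :: nat \<Rightarrow> nat \<Rightarrow> real. (\<forall>i<n. h i i = 0) \<longrightarrow>
      (\<Sum>i<n. \<Sum>j<n. A $$ (i, j) * h i j) = \<epsilon> * (\<Sum>i<n. \<Sum>j<n. w i j * h i j))"
proof -
  \<comment> \<open>This scale keeps every scaled row sum at most 1; the added 1 covers zero
    weights.\<close>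
  define \<epsilon> where "\<epsilon> = 1 / (1 + (\<Sum>i<n. \<Sum>j<n. w i j))"
  define A where "A = Matrix.mat n n (\<lambda>(i, j).
    (if i = j then 1 - \<epsilon> * (\<Sum>l<n. w i l) else 0) + \<epsilon> * w i j)"
  have row: "0 \<le> (\<Sum>l<n. w i l)" if "i < n" for i
    using that nonneg by (intro sum_nonneg) auto
  then have total: "0 \<le> (\<Sum>i<n. \<Sum>j<n. w i j)"
    by (intro sum_nonneg) (use nonneg in auto)
  then have \<epsilon>: "0 < \<epsilon>"
    by (simp add: \<epsilon>_def)
  have "\<epsilon> * (\<Sum>l<n. w i l) \<le> 1" if "i < n" for i
  proof -
    have "(\<Sum>l<n. w i l) \<le> (\<Sum>i<n. \<Sum>j<n. w i j)"
      using that row by (intro member_le_sum[of i "{..<n}" "\<lambda>i. \<Sum>l<n. w i l"]) auto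
    then show ?thesis
      using total by (simp add: \<epsilon>_def)
  qed
  then have A: "symmetric_stochastic n A"
    unfolding symmetric_stochastic_def
    using nonneg \<epsilon> sym
    by (auto intro!: eq_matI simp: A_def sum.distrib simp flip: sum_distrib_left)
  have "(\<Sum>i<n. \<Sum>j<n. A $$ (i, j) * h i j) = \<epsilon> * (\<Sum>i<n. \<Sum>j<n. w i j * h i j)"
    if "\<forall>i<n. h i i = 0" for h :: "nat \<Rightarrow> nat \<Rightarrow> real"
    unfolding sum_distrib_left
    by (intro sum.cong refl) (auto simp: A_def that)
  with A \<epsilon> show ?thesis
    by blast
qed

section \<open>From bounds on gamma to Euclidean embeddings and back\<close>

lemma not_constant_onD: "\<not> f constant_on S \<Longrightarrow> \<exists>a\<in>S. \<exists>b\<in>S. f a \<noteq> f b"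
  unfolding constant_on_def by metis

text \<open>The bound on \<open>gamma_sq\<close>, for the matrix built from given weights, verifies
  the hypothesis of \<open>psd_dominated_by_duality\<close>. A Gram factorization of the resulting
  kernel is the embedding.\<close>

lemma Euclidean_embedding_of_gamma_bound:
  assumes d: "Metric_space X d" and n: "2 \<le> n" and K: "0 \<le> K"
    and bound: "\<And>A. symmetric_stochastic n A \<Longrightarrow> gamma_sq n A X d \<le> gap_bound K A"
    and x: "x ` {..<n} \<subseteq> X"
  obtains F :: "nat \<Rightarrow> nat \<Rightarrow> real"
  where "\<And>i j. i < n \<Longrightarrow> j < n \<Longrightarrow> (\<Sum>k<n. (F k i - F k j)\<^sup>2) \<le> K * (d (x i) (x j))\<^sup>2"
    "(\<Sum>i<n. \<Sum>j<n. \<Sum>k<n. (F k i - F k j)\<^sup>2) = (\<Sum>i<n. \<Sum>j<n. (d (x i) (x j))\<^sup>2)"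
proof -
  interpret Metric_space X d by fact
  define S where "S = (\<Sum>i<n. \<Sum>j<n. (d (x i) (x j))\<^sup>2)"
  \<comment> \<open>A kernel with total sum 0 and trace \<open>s\<close> has squared distances
    summing to \<open>2 * real n * s\<close>, which this choice makes equal to
    \<open>S\<close>.\<close>
  define s where "s = S / (2 * real n)"
  have s: "0 \<le> s"
    by (auto simp: s_def S_def intro!: sum_nonneg divide_nonneg_nonneg)
  have d0: "d (x i) (x i) = 0" if "i < n" for i
    using that x by (intro mdist_zero) auto
  have "\<exists>G. (\<forall>i<n. \<forall>j<n. G i j = G j i) \<and>
      (\<forall>c. 0 \<le> (\<Sum>i<n. \<Sum>j<n. G i j * (c i * c j))) \<and>
      (\<Sum>i<n. \<Sum>j<n. G i j) = 0 \<and> (\<Sum>i<n. G i i) = s \<and>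
      (\<forall>i<n. \<forall>j<n. G i i + G j j - 2 * G i j \<le> K * (d (x i) (x j))\<^sup>2)"
  proof (rule psd_dominated_by_duality[of n "\<lambda>i j. K * (d (x i) (x j))\<^sup>2" s])
    show "K * (d (x i) (x j))\<^sup>2 = K * (d (x j) (x i))\<^sup>2" for i j
      by (simp add: commute)
    show "K * (d (x i) (x i))\<^sup>2 = 0" if "i < n" for i
      using d0[OF that] by simp
    show "0 \<le> s" by fact
    fix w :: "nat \<Rightarrow> nat \<Rightarrow> real"
    assume w: "\<And>i j. i < n \<Longrightarrow> j < n \<Longrightarrow> 0 \<le> w i j" "\<And>i j. i < n \<Longrightarrow> j < n \<Longrightarrow> w i j = w j i"
    obtain A \<epsilon> where A: "symmetric_stochastic n A" and \<epsilon>: "0 < \<epsilon>"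
      and energy: "\<And>h :: nat \<Rightarrow> nat \<Rightarrow> real. \<forall>i<n. h i i = 0 \<Longrightarrow>
        (\<Sum>i<n. \<Sum>j<n. A $$ (i, j) * h i j) = \<epsilon> * (\<Sum>i<n. \<Sum>j<n. w i j * h i j)"
      using symmetric_stochastic_of_weights[of n w, OF w] by blast
    obtain u where u: "(\<Sum>i<n. u i) = 0" "(\<Sum>i<n. (u i)\<^sup>2) = 1"
      and "(\<Sum>i<n. \<Sum>j<n. A $$ (i, j) * (u i - u j)\<^sup>2) = 2 * (1 - lambda 2 A)"
      using lambda_2_spectral_gap(3)[OF A n] by blast
    define U where "U = (\<Sum>i<n. \<Sum>j<n. w i j * (u i - u j)\<^sup>2)"
    define W where "W = (\<Sum>i<n. \<Sum>j<n. w i j * (d (x i) (x j))\<^sup>2)"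
    have gap: "\<epsilon> * U = 2 * (1 - lambda 2 A)"
      using energy[of "\<lambda>i j. (u i - u j)\<^sup>2"] \<open>_ = 2 * (1 - lambda 2 A)\<close> by (simp add: U_def)
    have W: "0 \<le> W"
      unfolding W_def using w(1) by (intro sum_nonneg mult_nonneg_nonneg) auto
    have "s * U \<le> K * W"
    proof (cases "lambda 2 A = 1")
      case True
      \<comment> \<open>The bound is infinite here and says nothing, but the weighted energy of
        \<open>u\<close> is 0.\<close>
      then have "U = 0"
        using gap \<epsilon> by simp
      then show ?thesis
        using K W by simp
    next
      case False
      then have pos: "0 < 1 - lambda 2 A"
        using lambda_2_spectral_gap(1)[OF A n] by simp
      have "gamma_sq n A X d \<le> ereal (K / (1 - lambda 2 A))"
        using bound[OF A] False by (simp add: gap_bound_def)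
      then have "S \<le> K / (1 - lambda 2 A) *
          (real n * (\<Sum>i<n. \<Sum>j<n. A $$ (i, j) * (d (x i) (x j))\<^sup>2))"
        unfolding S_def using n x symmetric_stochasticD(3)[OF A] by (intro gamma_sqD) auto
      also have "(\<Sum>i<n. \<Sum>j<n. A $$ (i, j) * (d (x i) (x j))\<^sup>2) = \<epsilon> * W"
        unfolding W_def by (rule energy) (simp add: d0)
      finally have "S * (1 - lambda 2 A) \<le> K * (real n * (\<epsilon> * W))"
        using pos by (simp add: pos_le_divide_eq)
      then have "2 * (S * (1 - lambda 2 A)) \<le> 2 * (K * (real n * (\<epsilon> * W)))"
        by simp
      \<comment> \<open>By \<open>gap\<close> the spectral gap disappears and both sides carry the
        factor \<epsilon>.\<close>
      also have "2 * (S * (1 - lambda 2 A)) = \<epsilon> * (S * U)"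
        using gap by (metis mult.left_commute)
      finally have "\<epsilon> * (S * U) \<le> \<epsilon> * (2 * real n * (K * W))"
        by (simp add: mult_ac)
      then have "S * U \<le> 2 * real n * (K * W)"
        using \<epsilon> by simp
      then show ?thesis
        using n by (simp add: s_def field_simps)
    qed
    then have "s * (\<Sum>i<n. \<Sum>j<n. w i j * (u i - u j)\<^sup>2) \<le>
        (\<Sum>i<n. \<Sum>j<n. w i j * (K * (d (x i) (x j))\<^sup>2))"
      by (simp add: U_def W_def sum_distrib_left mult_ac)
    with u show "\<exists>u. (\<Sum>i<n. u i) = 0 \<and> (\<Sum>i<n. (u i)\<^sup>2) = 1 \<and>
        s * (\<Sum>i<n. \<Sum>j<n. w i j * (u i - u j)\<^sup>2) \<le>
        (\<Sum>i<n. \<Sum>j<n. w i j * (K * (d (x i) (x j))\<^sup>2))"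
      by blast
  qed
  then obtain G where G: "\<forall>i<n. \<forall>j<n. G i j = G j i"
      "\<forall>c. 0 \<le> (\<Sum>i<n. \<Sum>j<n. G i j * (c i * c j))"
      "\<forall>i<n. \<forall>j<n. G i i + G j j - 2 * G i j \<le> K * (d (x i) (x j))\<^sup>2"
    and G_sum: "(\<Sum>i<n. \<Sum>j<n. G i j) = 0" and G_trace: "(\<Sum>i<n. G i i) = s"
    by blast
  obtain F where F: "\<And>i j. i < n \<Longrightarrow> j < n \<Longrightarrow> G i j = (\<Sum>k<n. F k i * F k j)"
    using psd_factorization[of n G] G(1,2) by blast
  have dist: "(\<Sum>k<n. (F k i - F k j)\<^sup>2) = G i i + G j j - 2 * G i j" if "i < n" "j < n" for i j
    using that by (simp add: F power2_eq_square algebra_simps sum.distrib sum_subtractf sum_distrib_left)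
  have "(\<Sum>i<n. \<Sum>j<n. \<Sum>k<n. (F k i - F k j)\<^sup>2) = (\<Sum>i<n. \<Sum>j<n. G i i + G j j - 2 * G i j)"
    by (intro sum.cong refl dist) auto
  also have "\<dots> = 2 * real n * s"
    by (simp add: sum.distrib sum_subtractf G_sum G_trace flip: sum_distrib_left)
  also have "\<dots> = S"
    using n by (simp add: s_def)
  finally show ?thesis
    using G(3) by (intro that[of F]) (simp_all add: dist S_def)
qed

text \<open>If \<open>lambda 2 A\<close> is not 1, then \<open>K / (1 - lambda 2 A)\<close> is
  positive and belongs to the set whose infimum is \<open>gamma_sq\<close>.\<close>

lemma gamma_sq_le_gap_bound:
  assumes n: "1 \<le> n" and K: "0 < K" and A: "symmetric_stochastic n A"
    and bound: "\<And>x. x ` {..<n} \<subseteq> X \<Longrightarrow>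
      (1 - lambda 2 A) * (\<Sum>i<n. \<Sum>j<n. (d (x i) (x j))\<^sup>2) \<le>
      K * (real n * (\<Sum>i<n. \<Sum>j<n. A $$ (i, j) * (d (x i) (x j))\<^sup>2))"
  shows "gamma_sq n A X d \<le> gap_bound K A"
proof (cases "lambda 2 A = 1")
  case True
  then show ?thesis
    by (simp add: gap_bound_def)
next
  case False
  have "lambda 2 A \<le> 1"
  proof (cases "n = 1")
    case True
    then show ?thesis
      using lambda_2_singleton symmetric_stochasticD(1)[OF A] by simp
  next
    case False
    then show ?thesis
      using lambda_2_spectral_gap(1)[OF A] n by simp
  qed
  then have pos: "0 < 1 - lambda 2 A"
    using False by simp
  have "1 / (real n)\<^sup>2 * (\<Sum>i<n. \<Sum>j<n. (d (x i) (x j))\<^sup>2) \<le>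
      K / (1 - lambda 2 A) / real n * (\<Sum>i<n. \<Sum>j<n. A $$ (i, j) * (d (x i) (x j))\<^sup>2)"
    if "x ` {..<n} \<subseteq> X" for x
  proof -
    have "(\<Sum>i<n. \<Sum>j<n. (d (x i) (x j))\<^sup>2) \<le>
        K * (real n * (\<Sum>i<n. \<Sum>j<n. A $$ (i, j) * (d (x i) (x j))\<^sup>2)) / (1 - lambda 2 A)"
      using bound[OF that] pos by (simp add: pos_le_divide_eq mult.commute)
    then have "1 / (real n)\<^sup>2 * (\<Sum>i<n. \<Sum>j<n. (d (x i) (x j))\<^sup>2) \<le> 1 / (real n)\<^sup>2 *
        (K * (real n * (\<Sum>i<n. \<Sum>j<n. A $$ (i, j) * (d (x i) (x j))\<^sup>2)) / (1 - lambda 2 A))"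
      by (rule mult_left_mono) simp
    also have "\<dots> = K / (1 - lambda 2 A) / real n * (\<Sum>i<n. \<Sum>j<n. A $$ (i, j) * (d (x i) (x j))\<^sup>2)"
      using n pos by (simp add: power2_eq_square)
    finally show ?thesis .
  qed
  then show ?thesis
    using False pos K n unfolding gamma_sq_def gap_bound_def
    by (auto intro!: Inf_lower)
qed

text \<open>No mapping on a single point is nonconstant, so the second assertion concerns tuples
  that are not constant.\<close>

theorem corollary1p4:
  fixes n :: nat and K :: real and X :: "'a set" and d :: "'a \<Rightarrow> 'a \<Rightarrow> real"
  assumes "n \<ge> 1" and "K \<ge> 1"
    and "Metric_space X d"
    and "\<exists>p\<in>X. \<exists>q\<in>X. p \<noteq> q"
  shows "(\<forall>A. symmetric_stochastic n A \<longrightarrow> gamma_sq n A X d \<le> gap_bound K A)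
    \<longleftrightarrow>
    (\<forall>D>K. \<forall>x::nat \<Rightarrow> 'a. x ` {..<n} \<subseteq> X \<longrightarrow> \<not> x constant_on {..<n} \<longrightarrow>
      (\<exists>f::'a \<Rightarrow> nat \<Rightarrow> real.
         f ` (x ` {..<n}) \<subseteq> ell2 \<and>
         \<not> f constant_on (x ` {..<n}) \<and>
         (\<Sum>i<n. \<Sum>j<n. (ell2_norm (f (x i) - f (x j)))\<^sup>2)
           \<ge> (lip_norm d (x ` {..<n}) f)\<^sup>2 / D * (\<Sum>i<n. \<Sum>j<n. (d (x i) (x j))\<^sup>2)))"
proof
  interpret Metric_space X d by fact
  assume gamma: "\<forall>A. symmetric_stochastic n A \<longrightarrow> gamma_sq n A X d \<le> gap_bound K A"
  show "\<forall>D>K. \<forall>x::nat \<Rightarrow> 'a. x ` {..<n} \<subseteq> X \<longrightarrow> \<not> x constant_on {..<n} \<longrightarrow>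
      (\<exists>f::'a \<Rightarrow> nat \<Rightarrow> real. f ` (x ` {..<n}) \<subseteq> ell2 \<and> \<not> f constant_on (x ` {..<n}) \<and>
         (\<Sum>i<n. \<Sum>j<n. (ell2_norm (f (x i) - f (x j)))\<^sup>2)
           \<ge> (lip_norm d (x ` {..<n}) f)\<^sup>2 / D * (\<Sum>i<n. \<Sum>j<n. (d (x i) (x j))\<^sup>2))"
  proof (intro allI impI)
    fix D and x :: "nat \<Rightarrow> 'a"
    assume D: "K < D" and x: "x ` {..<n} \<subseteq> X" and nc: "\<not> x constant_on {..<n}"
    obtain a b where ab: "a < n" "b < n" "x a \<noteq> x b"
      using not_constant_onD[OF nc] by auto
    then have n: "2 \<le> n"
      by (cases "n = 1") auto
    define S where "S = (\<Sum>i<n. \<Sum>j<n. (d (x i) (x j))\<^sup>2)"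
    have "0 < d (x a) (x b)"
      using ab x by (intro mdist_pos_less) auto
    then have S: "0 < S"
      unfolding S_def using ab by (intro sum_pos2[of _ a] sum_pos2[of _ b] sum_nonneg) auto
    obtain F :: "nat \<Rightarrow> nat \<Rightarrow> real" where
      F_le: "\<And>i j. i < n \<Longrightarrow> j < n \<Longrightarrow> (\<Sum>k<n. (F k i - F k j)\<^sup>2) \<le> K * (d (x i) (x j))\<^sup>2"
      and F_sum: "(\<Sum>i<n. \<Sum>j<n. \<Sum>k<n. (F k i - F k j)\<^sup>2) = S"
      using Euclidean_embedding_of_gamma_bound[OF assms(3) n _ _ x, of K] gamma assms(2)
      unfolding S_def by auto
    \<comment> \<open>\<open>F\<close> is indexed by positions but \<open>f\<close> has to be
      defined on points, so one position is chosen for each point.\<close>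
    define idx where "idx = (\<lambda>p. SOME i. i < n \<and> x i = p)"
    define f where "f = (\<lambda>p k. if k < n then F k (idx p) else 0)"
    have idx: "idx (x i) < n \<and> x (idx (x i)) = x i" if "i < n" for i
      unfolding idx_def by (rule someI[of _ i]) (simp add: that)
    \<comment> \<open>Equal points are at distance 0, so the bound \<open>F_le\<close> makes
      \<open>F\<close> agree at their positions and the choice is immaterial.\<close>
    have f: "f (x i) k = F k i" if "i < n" "k < n" for i k
    proof -
      have "d (x (idx (x i))) (x i) = 0"
        using idx[OF that(1)] that(1) x by (auto intro!: mdist_zero)
      then have "(\<Sum>k<n. (F k (idx (x i)) - F k i)\<^sup>2) \<le> 0"
        using F_le[of "idx (x i)" i] idx[OF that(1)] that(1) by simp
      then have "(\<Sum>k<n. (F k (idx (x i)) - F k i)\<^sup>2) = 0"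
        by (intro antisym sum_nonneg) auto
      then show ?thesis
        using that by (simp add: f_def sum_nonneg_eq_0_iff)
    qed
    have f_zero: "f p k = 0" if "n \<le> k" for p k
      using that by (simp add: f_def)
    have f_ell2: "f p \<in> ell2" for p
      by (rule finite_support_ell2(1)[of n]) (rule f_zero)
    have norm_f: "(ell2_norm (f (x i) - f (x j)))\<^sup>2 = (\<Sum>k<n. (F k i - F k j)\<^sup>2)"
      if "i < n" "j < n" for i j
      using that by (subst finite_support_ell2(2)[of n]) (auto simp: f_zero f intro!: sum.cong)
    have norm_sum: "(\<Sum>i<n. \<Sum>j<n. (ell2_norm (f (x i) - f (x j)))\<^sup>2) = S"
      unfolding F_sum[symmetric] by (intro sum.cong refl norm_f) auto
    have "\<not> f constant_on (x ` {..<n})"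
    proof
      assume "f constant_on (x ` {..<n})"
      then obtain c where "\<And>i. i < n \<Longrightarrow> f (x i) = c"
        by (auto simp: constant_on_def)
      then have "(\<Sum>i<n. \<Sum>j<n. (ell2_norm (f (x i) - f (x j)))\<^sup>2) = 0"
        by (simp add: ell2_norm_def)
      then show False
        using norm_sum S by simp
    qed
    \<comment> \<open>The squared image distances sum exactly to \<open>S\<close>; it remains to
      bound the squared Lipschitz constant by \<open>K\<close>, hence by \<open>D\<close>.\<close>
    moreover have "(lip_norm d (x ` {..<n}) f)\<^sup>2 / D * S \<le> S"
    proof -
      have "lip_norm d (x ` {..<n}) f \<le> sqrt K"
      proof (rule lip_norm_le)
        fix p q assume "p \<in> x ` {..<n}" "q \<in> x ` {..<n}"
        then obtain i j where ij: "i < n" "j < n" "p = x i" "q = x j"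
          by auto
        have "(ell2_norm (f p - f q))\<^sup>2 \<le> (sqrt K * d p q)\<^sup>2"
          using norm_f[OF ij(1,2)] F_le[OF ij(1,2)] ij assms(2) by (simp add: power_mult_distrib)
        then show "ell2_norm (f p - f q) \<le> sqrt K * d p q"
          by (rule power2_le_imp_le) (use assms(2) in simp)
      qed (use assms(2) in simp)
      moreover have "0 \<le> lip_norm d (x ` {..<n}) f"
        using x f_ell2 by (intro lip_norm_nonneg[OF assms(3)]) auto
      ultimately have "(lip_norm d (x ` {..<n}) f)\<^sup>2 \<le> (sqrt K)\<^sup>2"
        by (rule power_mono)
      also have "\<dots> \<le> D"
        using assms(2) D by simp
      finally have "(lip_norm d (x ` {..<n}) f)\<^sup>2 / D \<le> 1"
        using assms(2) D by simp
      then show ?thesis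
        using S by (intro mult_left_le_one_le) (use assms(2) D in auto)
    qed
    ultimately show "\<exists>f::'a \<Rightarrow> nat \<Rightarrow> real. f ` (x ` {..<n}) \<subseteq> ell2 \<and> \<not> f constant_on (x ` {..<n}) \<and>
         (\<Sum>i<n. \<Sum>j<n. (ell2_norm (f (x i) - f (x j)))\<^sup>2)
           \<ge> (lip_norm d (x ` {..<n}) f)\<^sup>2 / D * (\<Sum>i<n. \<Sum>j<n. (d (x i) (x j))\<^sup>2)"
      using f_ell2 norm_sum by (intro exI[of _ f]) (auto simp: S_def)
  qed
next
  interpret Metric_space X d by fact
  assume embed: "\<forall>D>K. \<forall>x::nat \<Rightarrow> 'a. x ` {..<n} \<subseteq> X \<longrightarrow> \<not> x constant_on {..<n} \<longrightarrow>
      (\<exists>f::'a \<Rightarrow> nat \<Rightarrow> real. f ` (x ` {..<n}) \<subseteq> ell2 \<and> \<not> f constant_on (x ` {..<n}) \<and>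
         (\<Sum>i<n. \<Sum>j<n. (ell2_norm (f (x i) - f (x j)))\<^sup>2)
           \<ge> (lip_norm d (x ` {..<n}) f)\<^sup>2 / D * (\<Sum>i<n. \<Sum>j<n. (d (x i) (x j))\<^sup>2))"
  show "\<forall>A. symmetric_stochastic n A \<longrightarrow> gamma_sq n A X d \<le> gap_bound K A"
  proof (intro allI impI)
    fix A assume A: "symmetric_stochastic n A"
    note A' = symmetric_stochasticD[OF A]
    show "gamma_sq n A X d \<le> gap_bound K A"
    proof (rule gamma_sq_le_gap_bound[OF assms(1) _ A])
      show "0 < K"
        using assms(2) by simp
      fix x :: "nat \<Rightarrow> 'a"
      assume x: "x ` {..<n} \<subseteq> X"
      define S where "S = (\<Sum>i<n. \<Sum>j<n. (d (x i) (x j))\<^sup>2)"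
      define E where "E = (\<Sum>i<n. \<Sum>j<n. A $$ (i, j) * (d (x i) (x j))\<^sup>2)"
      have E: "0 \<le> E"
        unfolding E_def using A'(3) by (intro sum_nonneg mult_nonneg_nonneg) auto
      have "(1 - lambda 2 A) * S \<le> K * (real n * E)"
      proof (cases "x constant_on {..<n}")
        case True
        \<comment> \<open>The embedding hypothesis is silent about constant tuples, but for them
          \<open>S = 0\<close>.\<close>
        then obtain p where p: "\<And>i. i < n \<Longrightarrow> x i = p"
          by (auto simp: constant_on_def)
        have "x 0 \<in> X"
          using x assms(1) by (simp add: image_subset_iff)
        then have "p \<in> X"
          using p[of 0] assms(1) by simp
        then have "S = 0"
          using p by (simp add: S_def)
        then show ?thesis
          using E assms(2) by simp
      next
        case False
        then have n: "2 \<le> n"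
          using assms(1) by (cases "n = 1") (auto simp: constant_on_def)
        have "lambda 2 A \<le> 1"
          using lambda_2_spectral_gap(1)[OF A n] .
        show ?thesis
        proof (rule le_mult_if_le_mult_greater)
          show "0 \<le> real n * E"
            using E by simp
          fix D assume D: "K < D"
          obtain f :: "'a \<Rightarrow> nat \<Rightarrow> real" where f: "f ` (x ` {..<n}) \<subseteq> ell2" "\<not> f constant_on (x ` {..<n})"
            and ge: "(\<Sum>i<n. \<Sum>j<n. (ell2_norm (f (x i) - f (x j)))\<^sup>2) \<ge>
              (lip_norm d (x ` {..<n}) f)\<^sup>2 / D * S"
            using embed D x False unfolding S_def by blast
          define L where "L = lip_norm d (x ` {..<n}) f"
          note lip = lip_norm[OF assms(3) _ x f(1), folded L_def]
          have f': "f (x i) \<in> ell2" if "i < n" for i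
            using f(1) that by auto
          \<comment> \<open>A nonconstant \<open>f\<close> has a positive Lipschitz constant, so its
            square can be cancelled at the end.\<close>
          obtain i j where ij: "i < n" "j < n" "f (x i) \<noteq> f (x j)"
            using not_constant_onD[OF f(2)] by auto
          then obtain k where "f (x i) k \<noteq> f (x j) k"
            by auto
          then have "0 < ell2_norm (f (x i) - f (x j))"
            using ij f' by (intro ell2_norm_pos[of _ k] ell2_diff) auto
          also have "\<dots> \<le> L * d (x i) (x j)"
            using ij by (intro lip(2)) auto
          finally have L: "0 < L"
            using lip(1) by (cases "L = 0") auto
          \<comment> \<open>In turn: the embedding inequality, the Poincare inequality for the
            points \<open>f (x i)\<close>, and the Lipschitz bound weighted by the nonnegative
            entries of \<open>A\<close>.\<close>
          have "(1 - lambda 2 A) * (L\<^sup>2 / D * S) \<le>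
              (1 - lambda 2 A) * (\<Sum>i<n. \<Sum>j<n. (ell2_norm (f (x i) - f (x j)))\<^sup>2)"
            using ge \<open>lambda 2 A \<le> 1\<close> by (intro mult_left_mono) (auto simp: L_def)
          also have "\<dots> \<le> real n * (\<Sum>i<n. \<Sum>j<n. A $$ (i, j) * (ell2_norm (f (x i) - f (x j)))\<^sup>2)"
            using poincare_inequality_ell2[OF A n, of "\<lambda>i. f (x i)"] f' by simp
          also have "\<dots> \<le> real n * (\<Sum>i<n. \<Sum>j<n. A $$ (i, j) * (L * d (x i) (x j))\<^sup>2)"
            using A'(3) f' lip(2)
            by (intro mult_left_mono sum_mono power_mono ell2_norm_nonneg ell2_diff) auto
          also have "\<dots> = L\<^sup>2 * (real n * E)"
            by (simp add: E_def power_mult_distrib sum_distrib_left mult_ac)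
          finally have "L\<^sup>2 * ((1 - lambda 2 A) * S / D) \<le> L\<^sup>2 * (real n * E)"
            by (simp add: mult_ac)
          then have "(1 - lambda 2 A) * S / D \<le> real n * E"
            by (rule mult_left_le_imp_le) (use L in simp)
          then show "(1 - lambda 2 A) * S \<le> D * (real n * E)"
            using D assms(2) by (simp add: pos_divide_le_eq mult.commute)
        qed
      qed
      then show "(1 - lambda 2 A) * (\<Sum>i<n. \<Sum>j<n. (d (x i) (x j))\<^sup>2) \<le>
          K * (real n * (\<Sum>i<n. \<Sum>j<n. A $$ (i, j) * (d (x i) (x j))\<^sup>2))"
        by (simp add: S_def E_def)
    qed
  qed
qed

end
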